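(* Let $n,k\ge 4$ be integers with $n\ge 2k+1$. Then $gp(Kn_{n,k})\le \binom{n-1}{k-1}$. Moreover, if $n\ge 2.5k-0.5$, then $gp(Kn_{n,k})=\binom{n-1}{k-1}$, while if $2k+1\le n<2.5k-0.5$, then $gp(Kn_{n,k})<\binom{n-1}{k-1}$.
   Context: For a connected graph $G$, a geodesic between two vertices $x,y$ is a shortest path from $x$ to $y$. A set $S$ of vertices of $G$ is in general position if no vertex of $S$ lies on any geodesic between two other vertices of $S$. The general position number $gp(G)$ is the maximum size of a set of vertices of $G$ in general position. The Kneser graph $Kn_{n,k}$ has vertex set $\binom{[n]}{k}$, the family of all $k$-element subsets of $[n]=\{1,\dots,n\}$, with two $k$-sets adjacent if and only if they are disjoint. *)

theory Defs
  imports Complex_Main "Graph_Theory.Graph_Theory"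
begin

context pre_digraph
begin

definition geodesic :: "'a \<Rightarrow> 'b awalk \<Rightarrow> 'a \<Rightarrow> bool" where
  "geodesic x p y \<longleftrightarrow> apath x p y \<and> (\<forall>q. apath x q y \<longrightarrow> length p \<le> length q)"

definition general_position :: "'a set \<Rightarrow> bool" where
  "general_position S \<longleftrightarrow> S \<subseteq> verts G \<and>
     (\<forall>x\<in>S. \<forall>y\<in>S. \<forall>z\<in>S. x \<noteq> y \<and> z \<noteq> x \<and> z \<noteq> y \<longrightarrow>
        \<not> (\<exists>p. geodesic x p y \<and> z \<in> set (awalk_verts x p)))"

definition gp :: nat where
  "gp = Max (card ` {S. general_position S})"

end

text \<open>Undirected graphs are symmetric digraphs: every edge gives two opposite arcs.\<close>

definition kneser_graph :: "nat \<Rightarrow> nat \<Rightarrow> nat set pair_pre_digraph" where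
  "kneser_graph n k =
     (let V = {A. A \<subseteq> {1..n} \<and> card A = k}
      in \<lparr> pverts = V, parcs = {(A, B). A \<in> V \<and> B \<in> V \<and> A \<inter> B = {}} \<rparr>)"

text \<open>For \<open>k = 0\<close> the empty set would carry a loop.\<close>

lemma pair_graph_kneser_graph:
  assumes "0 < k"
  shows "pair_graph (kneser_graph n k)"
proof -
  define V where "V = {A :: nat set. A \<subseteq> {1..n} \<and> card A = k}"
  define E where "E = {(A, B). A \<in> V \<and> B \<in> V \<and> A \<inter> B = {}}"
  have G: "pverts (kneser_graph n k) = V" "parcs (kneser_graph n k) = E"
    by (simp_all add: kneser_graph_def Let_def V_def E_def)
  have finV: "finite V" by (simp add: V_def)
  have "E \<subseteq> V \<times> V" by (auto simp: E_def)
  then have finE: "finite E" using finV by (meson finite_SigmaI finite_subset)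
  have "{} \<notin> V" using assms by (auto simp: V_def)
  then have loop: "fst e \<noteq> snd e" if "e \<in> E" for e
    using that by (auto simp: E_def)
  have "sym E" by (auto simp: E_def sym_def)
  then have "symmetric (with_proj (kneser_graph n k))"
    by (simp add: symmetric_def G)
  then show ?thesis
    using finV finE loop by unfold_locales (simp_all add: G, auto simp: E_def)
qed

end

theory Submission
  imports Defs "HOL-Combinatorics.Permutations"
begin

text \<open>
  Put \<open>r = n - 2 k\<close>. There is a walk of length \<open>2 m\<close> from \<open>X\<close> to \<open>Y\<close> iff \<open>card (X - Y) \<le> m r\<close>,
  and one of length \<open>2 m + 1\<close> iff \<open>card (X \<inter> Y) \<le> m r\<close>. Hence, in a family \<open>F\<close> in general
  position, disjointness is transitive on distinct members, and a member \<open>C\<close> other than two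
  disjoint members \<open>A\<close>, \<open>B\<close> satisfies \<open>\<bar>card (C \<inter> A) - card (C \<inter> B)\<bar> < r\<close>.

  The upper bound is a Katona cycle argument: on average over all cyclic orders, at most \<open>k\<close> arcs
  of length \<open>k\<close> have to belong to \<open>F\<close>. This is classical for a cyclic order in which the arcs from
  \<open>F\<close> pairwise intersect. If \<open>r \<le> k - 2\<close>, the balance condition leaves at most \<open>r + 2\<close> arcs as soon
  as two of them are disjoint. If \<open>r \<ge> k - 1\<close>, a cyclic order can carry \<open>k + 1\<close> arcs, but only when
  two members \<open>A\<close>, \<open>B\<close> whose sole disjoint partners are each other form adjacent arcs. Such
  orders are outnumbered by those in which \<open>A\<close> is an arc, \<open>B\<close> is not, and neither neighbour of the
  arc \<open>A\<close> lies in \<open>B\<close>; these carry at most \<open>k - 1\<close> arcs.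

  If \<open>2 r + 2 \<le> k\<close>, then \<open>k\<close> pairwise intersecting arcs are consecutive, and the arcs starting at
  \<open>q\<close>, \<open>q + 1\<close> and \<open>q + 1 + r\<close> violate general position, so some cyclic order carries fewer than
  \<open>k\<close> arcs. If \<open>2 r + 1 \<ge> k\<close>, all distances are at most 3, which makes a star a set in general
  position.
\<close>

section \<open>Walks in Kneser graphs\<close>

context wf_digraph
begin

text \<open>Since \<open>geodesic\<close> minimises over paths only, walks are brought in here: a
  walk of least length repeats no vertex, because a closed piece of it could be cut out.\<close>

lemma geodesic_if_shortest_awalk:
  assumes "awalk x p y" and "\<And>q. awalk x q y \<Longrightarrow> length p \<le> length q"
  shows "geodesic x p y"
proof -
  have "distinct (awalk_verts x p)"
  proof (rule ccontr)
    assume "\<not> distinct (awalk_verts x p)"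
    with assms(1) obtain q r s v where d: "p = q @ r @ s" "0 < length r"
      "awalk x q v" "awalk v r v" "awalk v s y"
      using awalk_not_distinct_decomp[of x p y] by blast
    then have "awalk x (q @ s) y" by auto
    from assms(2)[OF this] d show False by simp
  qed
  then have "apath x p y" using assms(1) by (simp add: apath_def)
  with assms(2) show ?thesis by (auto simp: geodesic_def apath_def)
qed

lemma ex_geodesic:
  assumes "awalk x p y"
  obtains q where "geodesic x q y" and "length q \<le> length p"
proof -
  obtain q where "awalk x q y" "\<And>q'. awalk x q' y \<Longrightarrow> length q \<le> length q'"
    using ex_has_least_nat[of "\<lambda>q. awalk x q y" p length] assms by blast
  with assms show thesis by (meson geodesic_if_shortest_awalk that)
qed

lemma geodesic_length_le:
  assumes "geodesic x p y" and "awalk x q y"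
  shows "length p \<le> length q"
  by (metis assms ex_geodesic geodesic_def order_trans)

text \<open>If the walk through \<open>z\<close> were shortest, it would be a geodesic containing
  \<open>z\<close>. The bounds on \<open>card F\<close> exploit betweenness only through such strict
  shortcuts.\<close>

lemma general_position_awalk_less:
  assumes "general_position S" and "x \<in> S" "y \<in> S" "z \<in> S" and "x \<noteq> y" "z \<noteq> x" "z \<noteq> y"
    and "awalk x p z" and "awalk z q y"
  obtains w where "awalk x w y" and "length w < length p + length q"
proof -
  have "\<exists>w. awalk x w y \<and> length w < length p + length q"
  proof (rule ccontr)
    assume "\<not> ?thesis"
    then have min: "\<And>w. awalk x w y \<Longrightarrow> length (p @ q) \<le> length w" by (simp add: not_less)
    have pq: "awalk x (p @ q) y" using assms by auto
    have "geodesic x (p @ q) y" by (rule geodesic_if_shortest_awalk[OF pq min])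
    moreover have "z \<in> set (awalk_verts x (p @ q))"
      using assms pq by (auto simp: set_awalk_verts_append)
    ultimately show False using assms(1-7) unfolding general_position_def by blast
  qed
  with that show thesis by blast
qed

end

lemma kneser_graph_simps [simp]:
  "pverts (kneser_graph n k) = {A. A \<subseteq> {1..n} \<and> card A = k}"
  "parcs (kneser_graph n k) =
     {(A, B). A \<subseteq> {1..n} \<and> card A = k \<and> B \<subseteq> {1..n} \<and> card B = k \<and> A \<inter> B = {}}"
  by (auto simp: kneser_graph_def Let_def)

locale kneser =
  fixes n k :: nat
  assumes k_pos: "0 < k" and n_ge: "2 * k + 1 \<le> n"
begin

definition V :: "nat set set" where "V = {A. A \<subseteq> {1..n} \<and> card A = k}"

abbreviation K :: "(nat set, nat set \<times> nat set) pre_digraph" where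
  "K \<equiv> with_proj (kneser_graph n k)"

abbreviation r :: nat where "r \<equiv> n - 2 * k"

lemma r_pos: "0 < r" using n_ge by simp

lemma wf_digraph_K: "wf_digraph K"
proof -
  interpret pair_graph "kneser_graph n k" by (rule pair_graph_kneser_graph[OF k_pos])
  show ?thesis by unfold_locales
qed

sublocale K: wf_digraph K by (rule wf_digraph_K)

section \<open>Walk lengths in terms of intersection sizes\<close>

lemma V_D:
  assumes "A \<in> V"
  shows "A \<subseteq> {1..n}" and "card A = k" and "finite A"
  using assms finite_subset[of A "{1..n}"] by (auto simp: V_def)

lemma finite_V: "finite V" by (simp add: V_def)

text \<open>Exact walk lengths take the place of distances because the criterion depends on the
  parity of the length.\<close>

definition walk :: "nat \<Rightarrow> nat set \<Rightarrow> nat set \<Rightarrow> bool" where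
  "walk l X Y \<longleftrightarrow> (\<exists>p. K.awalk X p Y \<and> length p = l)"

lemma walk_0_iff: "walk 0 X Y \<longleftrightarrow> X = Y \<and> X \<in> V"
  by (auto simp: walk_def K.awalk_Nil_iff V_def)

lemma walk_Suc_iff:
  "walk (Suc l) X Y \<longleftrightarrow> (\<exists>Z. X \<in> V \<and> Z \<in> V \<and> X \<inter> Z = {} \<and> walk l Z Y)"
proof
  assume "walk (Suc l) X Y"
  then obtain e p where "K.awalk X (e # p) Y" "length p = l"
    unfolding walk_def by (metis length_Suc_conv)
  then show "\<exists>Z. X \<in> V \<and> Z \<in> V \<and> X \<inter> Z = {} \<and> walk l Z Y"
    by (intro exI[of _ "snd e"]) (auto simp: K.awalk_Cons_iff walk_def V_def)
next
  assume "\<exists>Z. X \<in> V \<and> Z \<in> V \<and> X \<inter> Z = {} \<and> walk l Z Y"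
  then obtain Z p where "X \<in> V" "Z \<in> V" "X \<inter> Z = {}" "K.awalk Z p Y" "length p = l"
    by (auto simp: walk_def)
  then show "walk (Suc l) X Y"
    unfolding walk_def
    by (intro exI[of _ "(X, Z) # p"]) (auto simp: K.awalk_Cons_iff V_def)
qed

lemma card_Diff_V:
  assumes "X \<in> V" "Y \<in> V"
  shows "card (X - Y) + card (X \<inter> Y) = k"
  using V_D[OF assms(1)] by (metis card_Diff_subset_Int card_Int_Diff finite_Int add.commute)

lemma card_outside:
  assumes "X \<in> V" "Y \<in> V"
  shows "card ({1..n} - (X \<union> Y)) = r + card (X \<inter> Y)"
proof -
  have "card (X \<union> Y) + card (X \<inter> Y) = 2 * k"
    using card_Un_Int[of X Y] V_D[OF assms(1)] V_D[OF assms(2)] by simp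
  moreover have "card ({1..n} - (X \<union> Y)) = n - card (X \<union> Y)"
    using V_D[OF assms(1)] V_D[OF assms(2)] by (subst card_Diff_subset) auto
  moreover have "card (X \<union> Y) \<le> 2 * k" using calculation(1) by simp
  ultimately show ?thesis using n_ge by simp
qed

text \<open>This and \<open>card_Diff_le_if_disjoint\<close> limit what one edge from
  \<open>X\<close> to \<open>Z\<close> can do to the position relative to \<open>Y\<close>;
  \<open>ex_disjoint_near\<close> and \<open>ex_disjoint_far\<close> choose \<open>Z\<close> so that
  the limits are attained, up to truncation at 0.\<close>

lemma card_Int_le_if_disjoint:
  assumes "X \<in> V" "Y \<in> V" "Z \<in> V" "X \<inter> Z = {}"
  shows "card (X \<inter> Y) \<le> card (Z - Y)"
proof -
  have "Z \<inter> Y \<subseteq> Y - X" using assms(4) by blast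
  then have "card (Z \<inter> Y) \<le> card (Y - X)" using V_D[OF assms(2)] by (simp add: card_mono)
  then show ?thesis
    using card_Diff_V[OF assms(2,1)] card_Diff_V[OF assms(3,2)] by (simp add: Int_commute)
qed

lemma card_Diff_le_if_disjoint:
  assumes "X \<in> V" "Y \<in> V" "Z \<in> V" "X \<inter> Z = {}"
  shows "card (X - Y) \<le> r + card (Z \<inter> Y)"
proof -
  have "Z - Y \<subseteq> {1..n} - (X \<union> Y)" using assms(4) V_D[OF assms(3)] by blast
  then have "card (Z - Y) \<le> r + card (X \<inter> Y)"
    unfolding card_outside[OF assms(1,2), symmetric] by (simp add: card_mono)
  then show ?thesis
    using card_Diff_V[OF assms(1,2)] card_Diff_V[OF assms(3,2)] by simp
qed

text \<open>\<open>Z\<close> keeps \<open>Y - X\<close> and replaces the points of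
  \<open>X \<inter> Y\<close> by as many points outside \<open>X \<union> Y\<close>, where
  \<open>card_outside\<close> provides enough room.\<close>

lemma ex_disjoint_near:
  assumes "X \<in> V" "Y \<in> V"
  obtains Z where "Z \<in> V" "X \<inter> Z = {}" "card (Z - Y) = card (X \<inter> Y)"
proof -
  have "card (X \<inter> Y) \<le> card ({1..n} - (X \<union> Y))" using card_outside[OF assms] by simp
  then obtain T where T: "T \<subseteq> {1..n} - (X \<union> Y)" "card T = card (X \<inter> Y)" "finite T"
    by (rule obtain_subset_with_card_n)
  have "card ((Y - X) \<union> T) = card (Y - X) + card T"
    using T V_D[OF assms(2)] by (subst card_Un_disjoint) auto
  then have "(Y - X) \<union> T \<in> V"
    using T V_D[OF assms(2)] card_Diff_V[OF assms(2,1)] by (auto simp: V_def Int_commute)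
  moreover have "((Y - X) \<union> T) - Y = T" using T by auto
  ultimately show thesis using T by (intro that[of "(Y - X) \<union> T"]) auto
qed

text \<open>\<open>Z\<close> takes as many points outside \<open>X \<union> Y\<close> as possible.
  If \<open>card (X - Y) \<le> r\<close>, there are at least \<open>k\<close> of them and the
  truncated difference is 0; otherwise all of them are taken and the rest comes from
  \<open>Y - X\<close>.\<close>

lemma ex_disjoint_far:
  assumes "X \<in> V" "Y \<in> V"
  obtains Z where "Z \<in> V" "X \<inter> Z = {}" "card (Z \<inter> Y) = card (X - Y) - r"
proof (cases "card (X - Y) \<le> r")
  case True
  then have "k \<le> card ({1..n} - (X \<union> Y))"
    using card_outside[OF assms] card_Diff_V[OF assms] by simp
  then obtain T where "T \<subseteq> {1..n} - (X \<union> Y)" "card T = k" "finite T"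
    by (rule obtain_subset_with_card_n)
  moreover from this have "T \<inter> Y = {}" by auto
  ultimately show thesis using True by (intro that[of T]) (auto simp: V_def)
next
  case False
  let ?O = "{1..n} - (X \<union> Y)"
  have "card (X - Y) - r \<le> card (Y - X)"
    using card_Diff_V[OF assms] card_Diff_V[OF assms(2,1)] by (simp add: Int_commute)
  then obtain T where T: "T \<subseteq> Y - X" "card T = card (X - Y) - r" "finite T"
    by (rule obtain_subset_with_card_n)
  have "card (?O \<union> T) = card ?O + card T" using T by (subst card_Un_disjoint) auto
  then have "?O \<union> T \<in> V"
    using T False V_D[OF assms(2)] card_Diff_V[OF assms] card_outside[OF assms]
    by (auto simp: V_def)
  moreover have "(?O \<union> T) \<inter> Y = T" using T by auto
  ultimately show thesis using T by (intro that[of "?O \<union> T"]) auto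
qed

text \<open>Removing the first edge turns an odd walk from \<open>X\<close> into an even one from a
  neighbour \<open>Z\<close>, and vice versa; the extremal choices of \<open>Z\<close> make both
  criteria propagate. Each pair of edges gains \<open>r\<close>.\<close>

lemma walk_iff:
  assumes "X \<in> V" "Y \<in> V"
  shows "walk (2 * m) X Y \<longleftrightarrow> card (X - Y) \<le> m * r"
    and "walk (2 * m + 1) X Y \<longleftrightarrow> card (X \<inter> Y) \<le> m * r"
proof -
  \<comment> \<open>The odd criterion is derived from the even one for the same \<open>m\<close>, so
    it serves inside the induction as well as at the end.\<close>
  have odd: "walk (2 * m + 1) X Y \<longleftrightarrow> card (X \<inter> Y) \<le> m * r"
    if even: "\<And>Z. Z \<in> V \<Longrightarrow> walk (2 * m) Z Y \<longleftrightarrow> card (Z - Y) \<le> m * r" and X: "X \<in> V" for X m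
  proof
    assume "walk (2 * m + 1) X Y"
    then obtain Z where "Z \<in> V" "X \<inter> Z = {}" "card (Z - Y) \<le> m * r"
      using even by (auto simp: walk_Suc_iff)
    then show "card (X \<inter> Y) \<le> m * r"
      using card_Int_le_if_disjoint[OF X assms(2)] by fastforce
  next
    assume *: "card (X \<inter> Y) \<le> m * r"
    obtain Z where "Z \<in> V" "X \<inter> Z = {}" "card (Z - Y) = card (X \<inter> Y)"
      by (rule ex_disjoint_near[OF X assms(2)])
    then show "walk (2 * m + 1) X Y" using even X * by (auto simp: walk_Suc_iff)
  qed
  have even: "walk (2 * m) X Y \<longleftrightarrow> card (X - Y) \<le> m * r" if "X \<in> V" for X m
    using that
  proof (induction m arbitrary: X)
    case 0
    have "card (X - Y) = 0 \<longleftrightarrow> X = Y"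
      using V_D[OF 0] V_D[OF assms(2)] card_subset_eq[of Y X] by auto
    then show ?case using 0 by (simp add: walk_0_iff)
  next
    case (Suc m)
    have "walk (2 * Suc m) X Y \<longleftrightarrow> (\<exists>Z. Z \<in> V \<and> X \<inter> Z = {} \<and> card (Z \<inter> Y) \<le> m * r)"
      using odd[OF Suc.IH] Suc.prems by (auto simp: walk_Suc_iff[of "Suc (2 * m)"])
    also have "\<dots> \<longleftrightarrow> card (X - Y) \<le> Suc m * r"
    proof
      assume "\<exists>Z. Z \<in> V \<and> X \<inter> Z = {} \<and> card (Z \<inter> Y) \<le> m * r"
      then show "card (X - Y) \<le> Suc m * r"
        using card_Diff_le_if_disjoint[OF Suc.prems assms(2)] by fastforce
    next
      assume "card (X - Y) \<le> Suc m * r"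
      moreover obtain Z where "Z \<in> V" "X \<inter> Z = {}" "card (Z \<inter> Y) = card (X - Y) - r"
        by (rule ex_disjoint_far[OF Suc.prems assms(2)])
      ultimately show "\<exists>Z. Z \<in> V \<and> X \<inter> Z = {} \<and> card (Z \<inter> Y) \<le> m * r"
        by (intro exI[of _ Z]) auto
    qed
    finally show ?case .
  qed
  show "walk (2 * m) X Y \<longleftrightarrow> card (X - Y) \<le> m * r" by (rule even[OF assms(1)])
  show "walk (2 * m + 1) X Y \<longleftrightarrow> card (X \<inter> Y) \<le> m * r" by (rule odd[OF even assms(1)])
qed

section \<open>General position as conditions on intersection sizes\<close>

lemma general_position_walk_less:
  assumes "K.general_position F" and "X \<in> F" "Y \<in> F" "Z \<in> F" and "X \<noteq> Y" "Z \<noteq> X" "Z \<noteq> Y"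
    and "walk l X Z" and "walk m Z Y"
  obtains l' where "walk l' X Y" and "l' < l + m"
  using K.general_position_awalk_less[OF assms(1-7)] assms(8,9) unfolding walk_def by metis

lemma general_position_subset_V: "K.general_position F \<Longrightarrow> F \<subseteq> V"
  by (simp add: K.general_position_def V_def)

lemma walk_1_iff: "X \<in> V \<Longrightarrow> Y \<in> V \<Longrightarrow> walk 1 X Y \<longleftrightarrow> X \<inter> Y = {}"
  using walk_iff(2)[of X Y 0] V_D(3)[of X] by simp

text \<open>The walk from \<open>A\<close> over \<open>B\<close> to \<open>C\<close> has length 2,
  and a shorter walk between distinct sets is a single edge.\<close>

lemma general_position_disjoint_trans:
  assumes "K.general_position F" and "A \<in> F" "B \<in> F" "C \<in> F" and "A \<noteq> B" "B \<noteq> C" "A \<noteq> C"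
    and "A \<inter> B = {}" "B \<inter> C = {}"
  shows "A \<inter> C = {}"
proof -
  have V: "A \<in> V" "B \<in> V" "C \<in> V" using assms general_position_subset_V by auto
  have "walk 1 A B" "walk 1 B C" using V assms walk_1_iff by auto
  then obtain l where l: "walk l A C" "l < 1 + 1"
    using general_position_walk_less[OF assms(1,2,4,3)] assms by metis
  have "l \<noteq> 0" using l(1) assms(7) by (metis walk_0_iff)
  then have "l = 1" using l(2) by simp
  then show ?thesis using l V walk_1_iff by auto
qed

text \<open>If \<open>t + r \<le> s\<close> for the two intersection sizes, then \<open>A\<close> and \<open>B\<close> are at different distances
  from \<open>C\<close>, so the nearer one lies on a geodesic from \<open>C\<close> to the other.\<close>

lemma general_position_balanced:
  assumes gp: "K.general_position F" and F: "A \<in> F" "B \<in> F" "C \<in> F" and ne: "A \<noteq> B" "C \<noteq> A" "C \<noteq> B"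
    and AB: "A \<inter> B = {}"
  shows "card (C \<inter> A) < card (C \<inter> B) + r"
proof (rule ccontr)
  define s where "s = card (C \<inter> A)"
  define t where "t = card (C \<inter> B)"
  assume "\<not> ?thesis"
  then have st: "t + r \<le> s" by (simp add: s_def t_def)
  have V: "A \<in> V" "B \<in> V" "C \<in> V" using F gp general_position_subset_V by auto
  have dA: "card (C - A) = k - s" and dB: "card (C - B) = k - t" and sk: "s \<le> k"
    using card_Diff_V[OF V(3,1)] card_Diff_V[OF V(3,2)] by (auto simp: s_def t_def)
  have eA: "walk (2 * m) C A \<longleftrightarrow> k - s \<le> m * r" "walk (2 * m + 1) C A \<longleftrightarrow> s \<le> m * r" for m
    using walk_iff[OF V(3,1)] dA by (auto simp: s_def)
  have eB: "walk (2 * m) C B \<longleftrightarrow> k - t \<le> m * r" "walk (2 * m + 1) C B \<longleftrightarrow> t \<le> m * r" for m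
    using walk_iff[OF V(3,2)] dB by (auto simp: t_def)
  \<comment> \<open>\<open>2 * a\<close> is the length of the shortest even walk from
    \<open>C\<close> to \<open>A\<close>, and \<open>2 * b + 1\<close> that of the shortest odd walk
    from \<open>C\<close> to \<open>B\<close>.\<close>
  define a where "a = (LEAST m. k - s \<le> m * r)"
  define b where "b = (LEAST m. t \<le> m * r)"
  have ex: "x \<le> x * r" for x using r_pos by (cases r) auto
  have a: "k - s \<le> a * r" unfolding a_def by (rule LeastI[of _ "k - s"]) (rule ex)
  have a_min: "m * r < k - s" if "m < a" for m
    using not_less_Least[of m "\<lambda>m. k - s \<le> m * r"] that unfolding a_def by simp
  have b: "t \<le> b * r" unfolding b_def by (rule LeastI[of _ t]) (rule ex)
  have b_min: "m * r < t" if "m < b" for m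
    using not_less_Least[of m "\<lambda>m. t \<le> m * r"] that unfolding b_def by simp
  show False
  proof (cases "a \<le> b")
    case True
    \<comment> \<open>Over \<open>A\<close>, the set \<open>B\<close> is reached in
      \<open>2 * a + 1\<close> steps. A shorter even walk would need
      \<open>k - t \<le> a * r\<close>, which the gap \<open>t + r \<le> s\<close> excludes; a
      shorter odd one contradicts the minimality of \<open>b\<close>.\<close>
    have "walk 1 A B" using V AB walk_1_iff by blast
    then obtain l where l: "walk l C B" "l < 2 * a + 1"
      using general_position_walk_less[OF gp F(3,2,1), of "2 * a" 1] ne eA(1) a by metis
    show False
    proof (cases "even l")
      case True
      then obtain m where m: "l = 2 * m" by blast
      then have "m \<le> a" using l by simp
      then have "k - t \<le> a * r" using l eB m by (meson mult_le_mono1 order_trans)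
      \<comment> \<open>\<open>C \<noteq> A\<close> makes \<open>a\<close> positive, so minimality
        can be applied to \<open>a - 1\<close>.\<close>
      moreover have "a \<noteq> 0"
      proof
        assume "a = 0"
        then have "card (C - A) = 0" using a dA by simp
        then have "C \<subseteq> A" using V_D[OF V(3)] by simp
        then show False using V_D[OF V(3)] V_D[OF V(1)] ne by (metis card_subset_eq)
      qed
      then have "(a - 1) * r < k - s" by (intro a_min) simp
      then have "a * r < k - s + r" using \<open>a \<noteq> 0\<close> by (cases a) auto
      ultimately show False using st sk by linarith
    next
      case False
      then obtain m where m: "l = 2 * m + 1" by (blast elim: oddE)
      then have "t \<le> m * r" "m < b" using l eB \<open>a \<le> b\<close> by auto
      then show False using b_min by fastforce
    qed
  next
    case False
    \<comment> \<open>Over \<open>B\<close>, the set \<open>A\<close> is reached in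
      \<open>2 * b + 2\<close> steps: now an even shortcut contradicts the minimality of
      \<open>a\<close>, and an odd one needs \<open>s \<le> b * r < t + r\<close>.\<close>
    have "walk 1 B A" using V AB walk_1_iff by blast
    then obtain l where l: "walk l C A" "l < 2 * b + 1 + 1"
      using general_position_walk_less[OF gp F(3,1,2), of "2 * b + 1" 1] ne eB(2) b by metis
    show False
    proof (cases "even l")
      case True
      then obtain m where m: "l = 2 * m" by blast
      then have "k - s \<le> m * r" "m < a" using l eA False by auto
      then show False using a_min by fastforce
    next
      case odd: False
      then obtain m where m: "l = 2 * m + 1" by (blast elim: oddE)
      then have "m \<le> b" using l by simp
      then have "s \<le> b * r" using l eA m by (meson mult_le_mono1 order_trans)
      moreover have "b * r < t + r" 
      proof (cases b)
        case 0 then show ?thesis using r_pos by simp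
      next
        case (Suc b')
        then show ?thesis using b_min[of b'] by simp
      qed
      ultimately show False using st by linarith
    qed
  qed
qed

text \<open>Going from \<open>X\<close> over \<open>Z\<close> to \<open>Y\<close> takes 4 steps. The
  shortcut cannot have length 0 or 2, since \<open>r < card (X - Y)\<close>, so it has length 1 or
  3, and either bounds the intersection.\<close>

lemma general_position_no_middle:
  assumes gp: "K.general_position F" and F: "X \<in> F" "Y \<in> F" "Z \<in> F"
    and ne: "Z \<noteq> X" "Z \<noteq> Y"
    and d: "card (X - Z) \<le> r" "card (Z - Y) \<le> r" "r < card (X - Y)"
  shows "card (X \<inter> Y) \<le> r"
proof -
  have V: "X \<in> V" "Y \<in> V" "Z \<in> V" using F gp general_position_subset_V by auto
  have ne': "X \<noteq> Y" using d(3) by auto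
  have w: "walk 2 X Z" "walk 2 Z Y"
    using walk_iff(1)[OF V(1,3), of 1] walk_iff(1)[OF V(3,2), of 1] d by auto
  obtain l where l: "walk l X Y" "l < 2 + 2"
    using general_position_walk_less[OF gp F ne' ne w] .
  have "l = 0 \<or> l = 1 \<or> l = 2 \<or> l = 3" using l by auto
  moreover have "l \<noteq> 0" using l(1) ne' by (metis walk_0_iff)
  moreover have "l \<noteq> 2" using l walk_iff(1)[OF V(1,2), of 1] d by auto
  moreover have "card (X \<inter> Y) = 0" if "l = 1" using that l walk_1_iff[OF V(1,2)] by simp
  moreover have "card (X \<inter> Y) \<le> r" if "l = 3"
    using that l walk_iff(2)[OF V(1,2), of 1] by simp
  ultimately show ?thesis by auto
qed

text \<open>If both \<open>card (x - y)\<close> and \<open>card (x \<inter> y)\<close> exceeded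
  \<open>r\<close>, their sum \<open>k\<close> would be at least \<open>2 * r + 2\<close>; hence all
  distances are at most 3. Two members of the star are never adjacent, so a geodesic through a third
  member would have length at least 4.\<close>

lemma star_general_position:
  assumes "k \<le> 2 * r + 1"
  shows "K.general_position {A \<in> V. 1 \<in> A}"
  unfolding K.general_position_def
proof (intro conjI ballI impI notI)
  show "{A \<in> V. 1 \<in> A} \<subseteq> verts K" by (auto simp: V_def)
next
  fix x y z
  assume x: "x \<in> {A \<in> V. 1 \<in> A}" and y: "y \<in> {A \<in> V. 1 \<in> A}" and z: "z \<in> {A \<in> V. 1 \<in> A}"
    and ne: "x \<noteq> y \<and> z \<noteq> x \<and> z \<noteq> y"
    and "\<exists>p. K.geodesic x p y \<and> z \<in> set (K.awalk_verts x p)"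
  then obtain p where p: "K.geodesic x p y" "z \<in> set (K.awalk_verts x p)" by blast
  have V: "x \<in> V" "y \<in> V" "z \<in> V" using x y z by auto
  have "walk 2 x y \<or> walk 3 x y"
    using walk_iff(1)[OF V(1,2), of 1] walk_iff(2)[OF V(1,2), of 1] card_Diff_V[OF V(1,2)] assms
    by auto
  then obtain q where q: "K.awalk x q y" "length q \<le> 3" unfolding walk_def by auto
  with p have le: "length p \<le> 3" using K.geodesic_length_le order_trans by blast
  have "K.awalk x p y" using p by (auto simp: K.geodesic_def K.apath_def)
  then obtain p1 p2 where d: "p = p1 @ p2" "K.awalk x p1 z" "K.awalk z p2 y"
    using p(2) by (metis K.awalk_decomp)
  have two: "2 \<le> length q" if "K.awalk u q v" "u \<noteq> v" "u \<in> {A \<in> V. 1 \<in> A}" "v \<in> {A \<in> V. 1 \<in> A}" for u v q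
  proof -
    have w: "walk (length q) u v" using that walk_def by blast
    then have "length q \<noteq> 0" using that(2) by (metis walk_0_iff)
    moreover have "length q \<noteq> 1" using w that walk_1_iff[of u v] by auto
    ultimately show ?thesis by linarith
  qed
  have "2 \<le> length p1" "2 \<le> length p2" using two[OF d(2)] two[OF d(3)] ne x y z by auto
  then show False using d le by simp
qed

end

section \<open>Arcs of a cyclic order\<close>

text \<open>Equivalently, the disjointness graph on \<open>F\<close> is a disjoint union of
  cliques.\<close>

definition disjoint_trans :: "'a set set \<Rightarrow> bool" where
  "disjoint_trans F \<longleftrightarrow> (\<forall>A\<in>F. \<forall>B\<in>F. \<forall>C\<in>F. A \<noteq> B \<longrightarrow> B \<noteq> C \<longrightarrow> A \<noteq> C \<longrightarrow>
     A \<inter> B = {} \<longrightarrow> B \<inter> C = {} \<longrightarrow> A \<inter> C = {})"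

text \<open>An isolated edge of the disjointness graph on \<open>F\<close>.\<close>

definition private_pair :: "'a set set \<Rightarrow> 'a set \<Rightarrow> 'a set \<Rightarrow> bool" where
  "private_pair F A B \<longleftrightarrow> A \<in> F \<and> B \<in> F \<and> A \<noteq> B \<and> A \<inter> B = {} \<and>
     (\<forall>C\<in>F. C \<noteq> A \<longrightarrow> C \<noteq> B \<longrightarrow> C \<inter> A \<noteq> {} \<and> C \<inter> B \<noteq> {})"

lemma private_pair_unique:
  assumes "private_pair F A B" "private_pair F A B'"
  shows "B = B'"
  using assms unfolding private_pair_def by (metis Int_commute)

lemma card_le_1_if_all_eq:
  assumes "\<And>x y. x \<in> S \<Longrightarrow> y \<in> S \<Longrightarrow> x = y"
  shows "card S \<le> 1"
proof (cases "S = {}")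
  case False
  then obtain x where "x \<in> S" by blast
  then have "S = {x}" using assms by blast
  then show ?thesis by simp
qed simp

text \<open>A cyclic order is an \<open>n\<close>-periodic word on the integers, injective on each
  period. Arcs are then images of integer intervals, and positions are compared inside a window of
  \<open>n\<close> consecutive integers rather than modulo \<open>n\<close>.\<close>

locale circular_word =
  fixes n k :: nat and f :: "int \<Rightarrow> 'a"
  assumes k_pos: "0 < k" and n_gt: "2 * k < n"
    and f_eq_iff: "f i = f j \<longleftrightarrow> int n dvd i - j"
begin

section \<open>Arcs and their intersections\<close>

definition arc :: "int \<Rightarrow> 'a set" where "arc i = f ` {i..<i + int k}"

definition hits :: "'a set set \<Rightarrow> nat" where
  "hits F = card {i \<in> {0..<int n}. arc i \<in> F}"

lemma inj_on_window: "inj_on f {i..<i + int n}"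
proof (rule inj_onI)
  fix x y assume "x \<in> {i..<i + int n}" "y \<in> {i..<i + int n}" "f x = f y"
  then have "int n dvd x - y" "\<bar>x - y\<bar> < int n" using f_eq_iff by auto
  then show "x = y" using zdvd_not_zless[of "\<bar>x - y\<bar>" "int n"] by auto
qed

lemma arc_add_period: "arc (i + int n) = arc i"
proof -
  have "f (x + int n) = f x" for x by (simp add: f_eq_iff)
  moreover have "{i + int n..<i + int n + int k} = (\<lambda>x. x + int n) ` {i..<i + int k}"
    by (simp add: ac_simps)
  ultimately show ?thesis by (simp only: arc_def image_image)
qed

lemma arc_cong:
  assumes "int n dvd i - j"
  shows "arc i = arc j"
proof -
  have add: "arc (i + int n * int m) = arc i" for i m
  proof (induction m)
    case (Suc m)
    have "arc (i + int n * int (Suc m)) = arc (i + int n * int m + int n)"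
      by (simp add: algebra_simps)
    then show ?case using Suc arc_add_period by simp
  qed simp
  obtain c where c: "i - j = int n * c" using assms by blast
  show ?thesis
  proof (cases "c \<ge> 0")
    case True
    then have "i = j + int n * int (nat c)" using c by simp
    then show ?thesis using add by metis
  next
    case False
    then have "j = i + int n * int (nat (- c))" using c by simp
    then show ?thesis using add by metis
  qed
qed

lemma finite_arc: "finite (arc i)" by (simp add: arc_def)

lemma card_arc: "card (arc i) = k"
proof -
  have "inj_on f {i..<i + int k}"
    by (rule inj_on_subset[OF inj_on_window[of i]]) (use n_gt in auto)
  then show ?thesis by (simp add: arc_def card_image)
qed

text \<open>The two summands are the overlaps at the two ends of the arc at \<open>i\<close>; as
  \<open>2 * k < n\<close>, at most one is nonzero. The second case reduces to the first by moving
  \<open>j\<close> back by one period.\<close>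

lemma card_arc_Int:
  assumes "i \<le> j" "j \<le> i + int n"
  shows "card (arc i \<inter> arc j) = nat (int k - (j - i)) + nat (j - i + int k - int n)"
proof -
  have near: "card (arc i \<inter> arc j) = nat (int k - (j - i))"
    if "i \<le> j" "j \<le> i + int n - int k" for i j
  proof -
    have "arc i \<inter> arc j = f ` ({i..<i + int k} \<inter> {j..<j + int k})"
      unfolding arc_def
      by (rule inj_on_image_Int[OF inj_on_window[of i], symmetric]) (use that n_gt in auto)
    also have "{i..<i + int k} \<inter> {j..<j + int k} = {j..<i + int k}" using that by auto
    finally have "arc i \<inter> arc j = f ` {j..<i + int k}" .
    moreover have "inj_on f {j..<i + int k}"
      by (rule inj_on_subset[OF inj_on_window[of i]]) (use that n_gt in auto)
    ultimately show ?thesis by (simp add: card_image algebra_simps)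
  qed
  show ?thesis
  proof (cases "j \<le> i + int n - int k")
    case True
    then show ?thesis using near[of i j] assms by simp
  next
    case False
    have "arc j = arc (j - int n)" using arc_add_period[of "j - int n"] by simp
    moreover have "card (arc (j - int n) \<inter> arc i) = nat (int k - (i - (j - int n)))"
      using assms False n_gt by (intro near) auto
    ultimately show ?thesis using False n_gt by (simp add: Int_commute algebra_simps)
  qed
qed

lemma disjoint_arc_iff:
  assumes "i \<le> j" "j \<le> i + int n"
  shows "arc i \<inter> arc j = {} \<longleftrightarrow> int k \<le> j - i \<and> j - i \<le> int n - int k"
proof -
  have "arc i \<inter> arc j = {} \<longleftrightarrow> card (arc i \<inter> arc j) = 0" by (simp add: finite_arc)
  also have "\<dots> \<longleftrightarrow> int k \<le> j - i \<and> j - i \<le> int n - int k"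
    unfolding card_arc_Int[OF assms] by auto
  finally show ?thesis .
qed

lemma arc_eq_window:
  assumes "arc i = arc j" "i \<le> j" "j < i + int n"
  shows "i = j"
proof -
  have "nat (int k - (j - i)) + nat (j - i + int k - int n) = k"
    using card_arc_Int[of i j] card_arc[of i] assms by simp
  then show ?thesis using assms n_gt k_pos
    by (cases "j - i \<le> int n - int k") (auto simp: nat_eq_iff split: if_splits)
qed

lemma arc_eq_windowD:
  assumes "arc i = arc j" "i \<in> {p..<p + int n}" "j \<in> {p..<p + int n}"
  shows "i = j"
  using arc_eq_window[of i j] arc_eq_window[of j i] assms by (cases "i \<le> j") auto

lemma hits_window: "hits F = card {i \<in> {p..<p + int n}. arc i \<in> F}"
proof -
  have n: "int n > 0" using n_gt by simp
  define g where "g i = p + (i - p) mod int n" for i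
  have g_cong: "int n dvd i - g i" for i
    unfolding g_def by (metis diff_diff_eq dvd_minus_mod)
  have "bij_betw g {i \<in> {0..<int n}. arc i \<in> F} {i \<in> {p..<p + int n}. arc i \<in> F}"
  proof (rule bij_betw_byWitness[where f' = "\<lambda>i. i mod int n"])
    show "\<forall>a\<in>{i \<in> {0..<int n}. arc i \<in> F}. g a mod int n = a"
      by (simp add: g_def mod_simps)
    show "\<forall>a\<in>{i \<in> {p..<p + int n}. arc i \<in> F}. g (a mod int n) = a"
      by (simp add: g_def mod_simps)
    show "g ` {i \<in> {0..<int n}. arc i \<in> F} \<subseteq> {i \<in> {p..<p + int n}. arc i \<in> F}"
    proof clarify
      fix i assume "arc i \<in> F"
      moreover have "arc i = arc (g i)" by (rule arc_cong[OF g_cong])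
      ultimately show "g i \<in> {p..<p + int n} \<and> arc (g i) \<in> F" using n by (simp add: g_def)
    qed
    show "(\<lambda>i. i mod int n) ` {i \<in> {p..<p + int n}. arc i \<in> F} \<subseteq> {i \<in> {0..<int n}. arc i \<in> F}"
    proof clarify
      fix i assume "arc i \<in> F"
      moreover have "arc i = arc (i mod int n)" by (rule arc_cong) simp
      ultimately show "i mod int n \<in> {0..<int n} \<and> arc (i mod int n) \<in> F" using n by simp
    qed
  qed
  then show ?thesis unfolding hits_def by (rule bij_betw_same_card)
qed

text \<open>Katona's pairing: starting points of arcs in \<open>F\<close> lie less than
  \<open>k\<close> away from a fixed one \<open>p\<close>, and of the disjoint arcs at
  \<open>i\<close> and \<open>i + k\<close> at most one belongs to \<open>F\<close>. The equality
  case serves the strict bound.\<close>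

lemma intersecting_hits:
  assumes int: "\<And>i j. arc i \<in> F \<Longrightarrow> arc j \<in> F \<Longrightarrow> arc i \<inter> arc j \<noteq> {}"
  shows "hits F \<le> k"
    and "hits F = k \<Longrightarrow> \<exists>q. \<forall>i\<in>{q..<q + int k}. arc i \<in> F"
proof -
  define Y where "Y = {i. arc i \<in> F}"
  have meet: "j - i < int k" if "i \<in> Y" "j \<in> Y" "i \<le> j" "j - i \<le> int n - int k" for i j
    using int[of i j] disjoint_arc_iff[of i j] that by (auto simp: Y_def)
  have "hits F \<le> k \<and> (hits F = k \<longrightarrow> (\<exists>q. {q..<q + int k} \<subseteq> Y))"
  proof (cases "Y = {}")
    case True
    then have "hits F = 0" by (simp add: hits_def Y_def)
    then show ?thesis using k_pos by simp
  next
    case False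
    then obtain p where p: "p \<in> Y" by blast
    \<comment> \<open>The window begins \<open>k - 1\<close> places before \<open>p\<close>, so that
      no starting point near \<open>p\<close> is lost at its boundary.\<close>
    define W where "W = Y \<inter> {p - int k + 1..<p - int k + 1 + int n}"
    have W: "W \<subseteq> {p - int k + 1..<p + int k}"
    proof
      fix i assume i: "i \<in> W"
      show "i \<in> {p - int k + 1..<p + int k}"
      proof (cases "i \<le> p + int n - int k")
        case True
        then show ?thesis using i p meet[of p i] k_pos by (cases "p \<le> i") (auto simp: W_def)
      next
        case False
        then show ?thesis using i by (auto simp: W_def)
      qed
    qed
    have hits: "hits F = card W"
      unfolding hits_window[of F "p - int k + 1"] W_def Y_def by (rule arg_cong[where f = card]) auto
    \<comment> \<open>\<open>g\<close> folds \<open>i + k\<close> onto \<open>i\<close>, so it maps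
      \<open>W\<close> into \<open>k\<close> places; two distinct points with the same image would
      start disjoint arcs.\<close>
    define g where "g i = (if p < i then i - int k else i)" for i
    have g_inj: "inj_on g W"
    proof (rule inj_onI)
      fix x y assume xy: "x \<in> W" "y \<in> W" "g x = g y"
      have Y: "x \<in> Y" "y \<in> Y" using xy by (auto simp: W_def)
      show "x = y"
        using xy(3) meet[OF Y] meet[OF Y(2,1)] n_gt by (auto simp: g_def split: if_splits)
    qed
    have g_img: "g ` W \<subseteq> {p - int k + 1..p}" using W by (force simp: g_def)
    have "card W = card (g ` W)" using g_inj by (simp add: card_image)
    also have "\<dots> \<le> card {p - int k + 1..p}" using g_img by (intro card_mono) auto
    finally have le: "card W \<le> k" by simp
    have "\<exists>q. {q..<q + int k} \<subseteq> Y" if "card W = k"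
    proof -
      have img: "g ` W = {p - int k + 1..p}"
        using g_img \<open>card W = card (g ` W)\<close> that by (intro card_subset_eq) auto
      have sur: "i \<in> Y \<or> i + int k \<in> Y \<and> p < i + int k" if "i \<in> {p - int k + 1..p}" for i
      proof -
        from that have "i \<in> g ` W" by (simp only: img)
        then obtain x where "x \<in> W" "i = g x" by blast
        then show ?thesis by (cases "p < x") (auto simp: g_def W_def)
      qed
      define m where "m = Max W"
      have finW: "finite W" by (simp add: W_def)
      have pW: "p \<in> W" using p k_pos n_gt by (auto simp: W_def)
      have mW: "m \<in> W" unfolding m_def using finW pW by (intro Max_in) auto
      have m_max: "i \<le> m" if "i \<in> W" for i unfolding m_def using finW that by (rule Max_ge)
      have pm: "p \<le> m" using m_max pW .
      have mlt: "m < p + int k" using mW W by auto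
      \<comment> \<open>Downward from \<open>m\<close>: arcs \<open>k + 1\<close> places apart are
        disjoint because \<open>2 * k + 1 \<le> n\<close>, so \<open>i \<in> Y\<close> keeps
        \<open>i - 1 - k\<close> out of \<open>Y\<close>, and its partner \<open>i - 1\<close> must
        be in \<open>Y\<close>.\<close>
      have up: "i \<in> Y" if "p < i" "i \<le> m" for i
        using that(2,1)
      proof (induction i rule: int_le_induct)
        case base
        then show ?case using mW by (simp add: W_def)
      next
        case (step i)
        have "i - 1 - int k \<notin> Y" using meet[of "i - 1 - int k" i] step n_gt by auto
        then show ?case using sur[of "i - 1 - int k"] step mlt by auto
      qed
      \<comment> \<open>For \<open>i\<close> up to \<open>p\<close>, the partner
        \<open>i + k\<close> would exceed the largest starting point \<open>m\<close>.\<close>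
      have "i \<in> Y" if i: "i \<in> {m - int k + 1..<m - int k + 1 + int k}" for i
      proof (cases "p < i")
        case True
        then show ?thesis using up i by simp
      next
        case False
        have "i + int k \<notin> Y"
          using m_max[of "i + int k"] i False n_gt pm by (auto simp: W_def)
        then show ?thesis using sur[of i] i False pm by auto
      qed
      then show ?thesis by blast
    qed
    then show ?thesis using le hits by simp
  qed
  then show "hits F \<le> k"
    and "hits F = k \<Longrightarrow> \<exists>q. \<forall>i\<in>{q..<q + int k}. arc i \<in> F"
    by (auto simp: Y_def)
qed

end

section \<open>Cyclic orders with two disjoint arcs\<close>

lemma card_int_subset_le:
  fixes S :: "int set"
  assumes "S \<subseteq> {a..b}" and "2 * (b - a + 1) \<le> c" and "0 \<le> c"
  shows "2 * int (card S) \<le> c"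
proof -
  have "card S \<le> card {a..b}" using assms(1) by (intro card_mono) auto
  then show ?thesis using assms(2,3) by simp
qed

text \<open>\<open>S\<close> and \<open>Q\<close> stand for the starting points of the arcs between two disjoint arcs, on either side,
  where the points of \<open>Q\<close> are shifted by \<open>- k\<close>; then arcs at \<open>c \<in> S\<close> and \<open>q \<in> Q\<close> are disjoint iff
  \<open>q - c \<in> {0..r}\<close>.\<close>

lemma card_gap_le:
  fixes S Q :: "int set" and m r :: int
  assumes r: "1 \<le> r"
    and S: "\<And>c. c \<in> S \<Longrightarrow> m - r < 2 * c \<and> 2 * c < m + r"
    and Q: "\<And>q. q \<in> Q \<Longrightarrow> m < 2 * q \<and> 2 * q < m + 2 * r"
    and uniqS: "\<And>c c' q. c \<in> S \<Longrightarrow> c' \<in> S \<Longrightarrow> q \<in> Q \<Longrightarrow> q - c \<in> {0..r} \<Longrightarrow> q - c' \<in> {0..r} \<Longrightarrow> c = c'"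
    and uniqQ: "\<And>c q q'. c \<in> S \<Longrightarrow> q \<in> Q \<Longrightarrow> q' \<in> Q \<Longrightarrow> q - c \<in> {0..r} \<Longrightarrow> q' - c \<in> {0..r} \<Longrightarrow> q = q'"
  shows "int (card S) + int (card Q) \<le> r"
proof -
  \<comment> \<open>\<open>lo\<close> is the least integer \<open>c\<close> with
    \<open>m - r < 2 * c\<close>; at most \<open>r\<close> integers satisfy both bounds.\<close>
  define lo where "lo = (m - r) div 2 + 1"
  have "S \<subseteq> {lo..lo + r - 1}"
  proof
    fix c assume "c \<in> S"
    then have "m - r < 2 * c \<and> 2 * c < m + r" by (rule S)
    then show "c \<in> {lo..lo + r - 1}" unfolding lo_def by auto
  qed
  then have S_le: "card S \<le> card {lo..lo + r - 1}" and finS: "finite S"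
    using card_mono[of "{lo..lo + r - 1}" S] finite_subset[of S "{lo..lo + r - 1}"] by auto
  define lo' where "lo' = m div 2 + 1"
  have "Q \<subseteq> {lo'..lo' + r - 1}"
  proof
    fix c assume "c \<in> Q"
    then have "m < 2 * c \<and> 2 * c < m + 2 * r" by (rule Q)
    then show "c \<in> {lo'..lo' + r - 1}" unfolding lo'_def by auto
  qed
  then have Q_le: "card Q \<le> card {lo'..lo' + r - 1}" and finQ: "finite Q"
    using card_mono[of "{lo'..lo' + r - 1}" Q] finite_subset[of Q "{lo'..lo' + r - 1}"] by auto
  show ?thesis
  proof (cases "S = {} \<or> Q = {}")
    case True
    then show ?thesis using S_le Q_le r by auto
  next
    case False
    then obtain c q where c: "c \<in> S" and q: "q \<in> Q" by blast
    have cb: "m - r < 2 * c" "2 * c < m + r" using S[OF c] by auto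
    have qb: "m < 2 * q" "2 * q < m + 2 * r" using Q[OF q] by auto
    \<comment> \<open>For \<open>r = 1\<close> the bounds would force both \<open>2 * c = m\<close>
      and \<open>2 * q = m + 1\<close>.\<close>
    have r2: "2 \<le> r"
    proof (rule ccontr)
      assume "\<not> 2 \<le> r"
      then have "r = 1" using r by simp
      then have "2 * c = m" "2 * q = m + 1" using cb qb by auto
      then show False by presburger
    qed
    \<comment> \<open>The window \<open>{q - r..q}\<close> contains at most one point of
      \<open>S\<close>, by \<open>uniqS\<close>. What it leaves of the range of \<open>S\<close>
      lies on one side and holds at most \<open>(r - 2) / 2\<close> integers. The same holds for
      \<open>Q\<close> around \<open>c\<close>, and the total is \<open>r\<close>.\<close>
    define S1 where "S1 = {x \<in> S. q - x \<in> {0..r}}"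
    define S2 where "S2 = {x \<in> S. q - x \<notin> {0..r}}"
    have "S = S1 \<union> S2" "S1 \<inter> S2 = {}" by (auto simp: S1_def S2_def)
    then have S12: "card S = card S1 + card S2" using finS by (simp add: card_Un_disjoint)
    have S1: "card S1 \<le> 1"
    proof (rule card_le_1_if_all_eq)
      fix x y assume "x \<in> S1" "y \<in> S1" then show "x = y" using uniqS q unfolding S1_def by blast
    qed
    have S2: "2 * int (card S2) \<le> r - 2"
    proof (cases "m + r \<le> 2 * q")
      case True
      show ?thesis
      proof (rule card_int_subset_le)
        show "S2 \<subseteq> {(m - r) div 2 + 1..q - r - 1}" using S True unfolding S2_def by force
        show "2 * (q - r - 1 - ((m - r) div 2 + 1) + 1) \<le> r - 2" using qb by presburger
      qed (use r2 in simp)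
    next
      case False
      show ?thesis
      proof (rule card_int_subset_le)
        show "S2 \<subseteq> {q + 1..(m + r - 1) div 2}" using S False qb unfolding S2_def by force
        show "2 * ((m + r - 1) div 2 - (q + 1) + 1) \<le> r - 2" using qb by presburger
      qed (use r2 in simp)
    qed
    define Q1 where "Q1 = {x \<in> Q. x - c \<in> {0..r}}"
    define Q2 where "Q2 = {x \<in> Q. x - c \<notin> {0..r}}"
    have "Q = Q1 \<union> Q2" "Q1 \<inter> Q2 = {}" by (auto simp: Q1_def Q2_def)
    then have Q12: "card Q = card Q1 + card Q2" using finQ by (simp add: card_Un_disjoint)
    have Q1: "card Q1 \<le> 1"
    proof (rule card_le_1_if_all_eq)
      fix x y assume "x \<in> Q1" "y \<in> Q1" then show "x = y" using uniqQ c unfolding Q1_def by blast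
    qed
    have Q2: "2 * int (card Q2) \<le> r - 2"
    proof (cases "m \<le> 2 * c")
      case True
      show ?thesis
      proof (rule card_int_subset_le)
        show "Q2 \<subseteq> {m div 2 + 1..c - 1}" using Q True cb unfolding Q2_def by force
        show "2 * (c - 1 - (m div 2 + 1) + 1) \<le> r - 2" using cb by presburger
      qed (use r2 in simp)
    next
      case False
      show ?thesis
      proof (rule card_int_subset_le)
        show "Q2 \<subseteq> {c + r + 1..(m + 2 * r - 1) div 2}" using Q False cb unfolding Q2_def by force
        show "2 * ((m + 2 * r - 1) div 2 - (c + r + 1) + 1) \<le> r - 2" using cb by presburger
      qed (use r2 in simp)
    qed
    show ?thesis using S12 S1 S2 Q12 Q1 Q2 by linarith
  qed
qed

context circular_word
begin

lemma disjoint_arcsE: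
  assumes "arc a \<inter> arc b = {}"
  obtains b' where "arc b' = arc b" "a + int k \<le> b'" "b' \<le> a + int n - int k"
proof -
  have n: "int n > 0" using n_gt by simp
  define b' where "b' = a + (b - a) mod int n"
  have "int n dvd b - b'"
    unfolding b'_def by (metis diff_diff_eq dvd_minus_mod)
  then have eq: "arc b' = arc b" using arc_cong by metis
  have "a \<le> b'" "b' \<le> a + int n" using n by (auto simp: b'_def less_imp_le)
  then have "int k \<le> b' - a \<and> b' - a \<le> int n - int k"
    using disjoint_arc_iff[of a b'] assms eq by simp
  then show thesis using that eq by simp
qed

lemma disjoint_transD:
  assumes "disjoint_trans F" "arc x \<in> F" "arc y \<in> F" "arc z \<in> F"
    and "arc x \<inter> arc y = {}" "arc y \<inter> arc z = {}" "arc x \<inter> arc z \<noteq> {}"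
  shows "arc x = arc z"
proof (rule ccontr)
  assume "arc x \<noteq> arc z"
  moreover have "arc i \<noteq> {}" for i using card_arc[of i] k_pos by auto
  then have "arc x \<noteq> arc y" "arc y \<noteq> arc z" using assms(5,6) by auto
  ultimately show False using assms unfolding disjoint_trans_def by blast
qed

text \<open>With \<open>n < 3 * k\<close> no three arcs are pairwise disjoint, so by transitivity
  every further arc in \<open>F\<close> meets both \<open>arc a\<close> and \<open>arc b\<close>.
  Balance then confines the starting points on either side to the middle of the gap, where
  \<open>card_gap_le\<close> admits at most \<open>n - 2 * k\<close> in total; the two disjoint arcs
  account for the \<open>+ 2\<close>.\<close>

lemma hits_le_if_balanced:
  assumes tr: "disjoint_trans F"
    and bal: "\<And>A B C. A \<in> F \<Longrightarrow> B \<in> F \<Longrightarrow> C \<in> F \<Longrightarrow> A \<noteq> B \<Longrightarrow> C \<noteq> A \<Longrightarrow> C \<noteq> B \<Longrightarrow> A \<inter> B = {} \<Longrightarrow>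
      card (C \<inter> A) < card (C \<inter> B) + (n - 2 * k)"
    and n: "n + 2 \<le> 3 * k"
    and ab: "arc a \<in> F" "arc b \<in> F" "arc a \<inter> arc b = {}"
  shows "hits F \<le> n - 2 * k + 2"
proof -
  define r where "r = int n - 2 * int k"
  obtain b' where b': "arc b' = arc b" "a + int k \<le> b'" "b' \<le> a + int n - int k"
    by (rule disjoint_arcsE[OF ab(3)])
  have F: "arc a \<in> F" "arc b' \<in> F" using ab b' by auto
  have dis: "arc a \<inter> arc b' = {}" using ab b' by simp
  define S where "S = {c. a < c \<and> c < b' \<and> arc c \<in> F}"
  define Q where "Q = {c. b' < c \<and> c < a + int n \<and> arc c \<in> F}"
  have neq: "arc c \<noteq> arc d" if "c \<in> {a..<a + int n}" "d \<in> {a..<a + int n}" "c \<noteq> d" for c d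
    using arc_eq_windowD that by blast
  have Sb: "\<bar>2 * c - a - b'\<bar> < r \<and> c - a < int k \<and> b' - c < int k" if "c \<in> S" for c
  proof -
    have c: "a < c" "c < b'" "arc c \<in> F" using that by (auto simp: S_def)
    have ne: "arc a \<noteq> arc b'" "arc c \<noteq> arc a" "arc c \<noteq> arc b'"
      using neq[of a b'] neq[of c a] neq[of c b'] c(1,2) b'(2,3) k_pos by auto
    have d1: "arc a \<inter> arc c = {} \<longleftrightarrow> int k \<le> c - a"
      using disjoint_arc_iff[of a c] c b' k_pos by auto
    have d2: "arc c \<inter> arc b' = {} \<longleftrightarrow> int k \<le> b' - c"
      using disjoint_arc_iff[of c b'] c b' k_pos by auto
    have "\<not> int k \<le> c - a \<and> \<not> int k \<le> b' - c"
    proof (rule ccontr)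
      assume "\<not> ?thesis"
      then have "arc c \<inter> arc a = {} \<or> arc c \<inter> arc b' = {}" using d1 d2 by auto
      then have "arc c \<inter> arc a = {} \<and> arc c \<inter> arc b' = {}"
        using disjoint_transD[OF tr c(3) F(1) F(2) _ dis] disjoint_transD[OF tr c(3) F(2) F(1)] dis ne
        by blast
      then show False using d1 d2 b' n by auto
    qed
    then have lt: "c - a < int k" "b' - c < int k" by auto
    have "card (arc c \<inter> arc a) = nat (int k - (c - a))"
      using card_arc_Int[of a c] c b' by (simp add: Int_commute)
    moreover have "card (arc c \<inter> arc b') = nat (int k - (b' - c))"
      using card_arc_Int[of c b'] c b' by simp
    moreover have "card (arc c \<inter> arc a) < card (arc c \<inter> arc b') + (n - 2 * k)"
      using bal[OF F c(3) ne dis] .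
    moreover have "card (arc c \<inter> arc b') < card (arc c \<inter> arc a) + (n - 2 * k)"
      using bal[OF F(2,1) c(3) ne(1)[symmetric] ne(3,2)] dis by (simp add: Int_commute)
    ultimately show ?thesis using lt n_gt unfolding r_def by linarith
  qed
  have Qb: "\<bar>2 * c - a - b' - int n\<bar> < r \<and> c - b' < int k \<and> a + int n - c < int k" if "c \<in> Q" for c
  proof -
    have c: "b' < c" "c < a + int n" "arc c \<in> F" using that by (auto simp: Q_def)
    have ne: "arc a \<noteq> arc b'" "arc c \<noteq> arc a" "arc c \<noteq> arc b'"
      using neq[of a b'] neq[of c a] neq[of c b'] c(1,2) b'(2,3) k_pos by auto
    have aa: "arc (a + int n) = arc a" by (rule arc_add_period)
    have d1: "arc c \<inter> arc a = {} \<longleftrightarrow> int k \<le> a + int n - c"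
      using disjoint_arc_iff[of c "a + int n"] c b' k_pos aa by auto
    have d2: "arc b' \<inter> arc c = {} \<longleftrightarrow> int k \<le> c - b'"
      using disjoint_arc_iff[of b' c] c b' k_pos by auto
    have "\<not> int k \<le> a + int n - c \<and> \<not> int k \<le> c - b'"
    proof (rule ccontr)
      assume "\<not> ?thesis"
      then have "arc c \<inter> arc a = {} \<or> arc c \<inter> arc b' = {}" using d1 d2 by auto
      then have "arc c \<inter> arc a = {} \<and> arc c \<inter> arc b' = {}"
        using disjoint_transD[OF tr c(3) F(1) F(2) _ dis] disjoint_transD[OF tr c(3) F(2) F(1)] dis ne
        by blast
      then show False using d1 d2 b' n by auto
    qed
    then have lt: "a + int n - c < int k" "c - b' < int k" by auto
    have "card (arc c \<inter> arc a) = nat (int k - (a + int n - c))"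
      using card_arc_Int[of c "a + int n"] c b' aa k_pos by simp
    moreover have "card (arc c \<inter> arc b') = nat (int k - (c - b'))"
      using card_arc_Int[of b' c] c b' by (simp add: Int_commute)
    moreover have "card (arc c \<inter> arc a) < card (arc c \<inter> arc b') + (n - 2 * k)"
      using bal[OF F c(3) ne dis] .
    moreover have "card (arc c \<inter> arc b') < card (arc c \<inter> arc a) + (n - 2 * k)"
      using bal[OF F(2,1) c(3) ne(1)[symmetric] ne(3,2)] dis by (simp add: Int_commute)
    ultimately show ?thesis using lt n_gt unfolding r_def by linarith
  qed
  have SQ: "arc c \<inter> arc q = {}" if "c \<in> S" "q \<in> Q" "q - int k - c \<in> {0..r}" for c q
    using disjoint_arc_iff[of c q] that unfolding S_def Q_def r_def by auto
  have le: "int (card S) + int (card ((\<lambda>q. q - int k) ` Q)) \<le> r"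
  proof (rule card_gap_le[where m = "a + b'"])
    show "1 \<le> r" using n_gt by (simp add: r_def)
    show "a + b' - r < 2 * c \<and> 2 * c < a + b' + r" if "c \<in> S" for c
      using Sb[OF that] by linarith
    show "a + b' < 2 * q \<and> 2 * q < a + b' + 2 * r" if q: "q \<in> (\<lambda>q. q - int k) ` Q" for q
    proof -
      obtain y where "y \<in> Q" "q = y - int k" using q by blast
      then show ?thesis using Qb[of y] unfolding r_def by auto
    qed
    show "c = c'" if S: "c \<in> S" "c' \<in> S" and q: "q \<in> (\<lambda>q. q - int k) ` Q"
      and "q - c \<in> {0..r}" "q - c' \<in> {0..r}" for c c' q
    proof -
      obtain y where y: "y \<in> Q" "q = y - int k" using q by blast
      have "arc c \<inter> arc y = {}" "arc y \<inter> arc c' = {}" using SQ[OF _ y(1)] that y by auto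
      \<comment> \<open>Both start after \<open>b' - k\<close> and before \<open>a + k\<close>,
        hence less than \<open>k\<close> places apart.\<close>
      moreover have "arc c \<inter> arc c' \<noteq> {}"
      proof (cases "c \<le> c'")
        case True
        then show ?thesis using disjoint_arc_iff[of c c'] S Sb[of c] Sb[of c'] b'
          by (auto simp: S_def)
      next
        case False
        then show ?thesis using disjoint_arc_iff[of c' c] S Sb[of c] Sb[of c'] b'
          by (auto simp: S_def Int_commute)
      qed
      ultimately have "arc c = arc c'"
        using S y by (intro disjoint_transD[OF tr, of c y c']) (auto simp: S_def Q_def)
      then show ?thesis using neq[of c c'] S b' by (auto simp: S_def)
    qed
    show "q = q'" if c: "c \<in> S" and q: "q \<in> (\<lambda>q. q - int k) ` Q" and q': "q' \<in> (\<lambda>q. q - int k) ` Q"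
      and "q - c \<in> {0..r}" "q' - c \<in> {0..r}" for c q q'
    proof -
      obtain y where y: "y \<in> Q" "q = y - int k" using q by blast
      obtain z where z: "z \<in> Q" "q' = z - int k" using q' by blast
      have "arc c \<inter> arc y = {}" "arc c \<inter> arc z = {}" using SQ[OF c] y z that by auto
      moreover have "arc y \<inter> arc z \<noteq> {}"
      proof (cases "y \<le> z")
        case True
        then show ?thesis using disjoint_arc_iff[of y z] y z Qb[of y] Qb[of z] b'
          by (auto simp: Q_def)
      next
        case False
        then show ?thesis using disjoint_arc_iff[of z y] y z Qb[of y] Qb[of z] b'
          by (auto simp: Q_def Int_commute)
      qed
      ultimately have "arc y = arc z"
        using c y z by (intro disjoint_transD[OF tr, of y c z]) (auto simp: S_def Q_def Int_commute)
      then show ?thesis using neq[of y z] y z b' by (auto simp: Q_def)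
    qed
  qed
  have "card ((\<lambda>q. q - int k) ` Q) = card Q" by (rule card_image) (auto simp: inj_on_def)
  moreover have "{i \<in> {a..<a + int n}. arc i \<in> F} = {a, b'} \<union> S \<union> Q"
    using F b' k_pos n_gt unfolding S_def Q_def by auto
  then have "hits F = card ({a, b'} \<union> S \<union> Q)" using hits_window[of F a] by simp
  moreover have "card ({a, b'} \<union> S \<union> Q) \<le> card {a, b'} + card S + card Q"
    by (meson add_le_mono card_Un_le le_trans order_refl)
  moreover have "card {a, b'} \<le> 2" by (simp add: card_insert_if)
  ultimately show ?thesis using le n_gt unfolding r_def by linarith
qed

text \<open>\<open>arc (a + 1)\<close> lies in the union of the two arcs and meets both. A member
  disjoint from both would be disjoint from it too, and transitivity would separate
  \<open>arc (a + 1)\<close> from \<open>arc a\<close>. By transitivity, a member disjoint from one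
  of the two is disjoint from both.\<close>

lemma private_pair_if_adjacent:
  assumes tr: "disjoint_trans F" and k: "2 \<le> k"
    and F: "arc a \<in> F" "arc (a + 1) \<in> F" "arc (a + int k) \<in> F"
  shows "private_pair F (arc a) (arc (a + int k))"
  unfolding private_pair_def
proof (intro conjI ballI impI F)
  have ne: "arc i \<noteq> {}" for i using card_arc[of i] k_pos by auto
  show dis: "arc a \<inter> arc (a + int k) = {}" using disjoint_arc_iff[of a "a + int k"] n_gt by auto
  then show "arc a \<noteq> arc (a + int k)" using ne by auto
  have meet: "arc (a + 1) \<inter> arc a \<noteq> {}" "arc (a + 1) \<inter> arc (a + int k) \<noteq> {}"
    using disjoint_arc_iff[of a "a + 1"] disjoint_arc_iff[of "a + 1" "a + int k"] n_gt k
    by (auto simp: Int_commute)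
  have neq: "arc (a + 1) \<noteq> arc a" "arc (a + 1) \<noteq> arc (a + int k)"
    using arc_eq_window[of a "a + 1"] arc_eq_window[of "a + 1" "a + int k"] n_gt k by auto
  have sub: "arc (a + 1) \<subseteq> arc a \<union> arc (a + int k)"
    unfolding arc_def image_Un[symmetric] by (rule image_mono) auto
  fix C assume C: "C \<in> F" "C \<noteq> arc a" "C \<noteq> arc (a + int k)"
  have no_both: False if d: "C \<inter> arc a = {}" "C \<inter> arc (a + int k) = {}"
  proof -
    have "arc (a + 1) \<inter> C = {}" using d sub by blast
    moreover from this have "arc (a + 1) \<noteq> C" using ne by auto
    ultimately show False
      using tr F C d(1) meet(1) neq(1) unfolding disjoint_trans_def by blast
  qed
  show "C \<inter> arc a \<noteq> {}"
    using no_both tr F C dis \<open>arc a \<noteq> arc (a + int k)\<close> unfolding disjoint_trans_def by blast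
  show "C \<inter> arc (a + int k) \<noteq> {}"
  proof
    assume "C \<inter> arc (a + int k) = {}"
    moreover from this have "C \<inter> arc a = {}"
      using tr F C dis \<open>arc a \<noteq> arc (a + int k)\<close> unfolding disjoint_trans_def
      by (metis Int_commute)
    ultimately show False by (rule no_both[rotated])
  qed
qed

text \<open>Given two disjoint arcs from \<open>F\<close>, a third one disjoint from the first makes
  all arcs from \<open>F\<close> pairwise disjoint, and \<open>cl\<close> applies. Otherwise all
  others meet both, and more than \<open>k\<close> hits arise only by filling the gap of an adjacent
  pair completely, which makes that pair private.\<close>

lemma hits_le_or_private:
  assumes tr: "disjoint_trans F"
    and cl: "\<And>D. D \<subseteq> F \<Longrightarrow> (\<And>A B. A \<in> D \<Longrightarrow> B \<in> D \<Longrightarrow> A \<noteq> B \<Longrightarrow> A \<inter> B = {}) \<Longrightarrow> card D \<le> k"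
    and k4: "4 \<le> k" and n: "3 * k \<le> n + 1"
  shows "hits F \<le> k \<or> hits F \<le> k + 1 \<and> (\<exists>i. private_pair F (arc i) (arc (i + int k)))"
proof (cases "\<exists>a b. arc a \<in> F \<and> arc b \<in> F \<and> arc a \<inter> arc b = {}")
  case False
  then have "hits F \<le> k" by (intro intersecting_hits(1)) blast
  then show ?thesis ..
next
  case True
  then obtain a b0 where ab0: "arc a \<in> F" "arc b0 \<in> F" "arc a \<inter> arc b0 = {}" by blast
  obtain b where b: "arc b = arc b0" "a + int k \<le> b" "b \<le> a + int n - int k"
    by (rule disjoint_arcsE[OF ab0(3)])
  have F: "arc a \<in> F" "arc b \<in> F" and dis: "arc a \<inter> arc b = {}" using ab0 b by auto
  define Z where "Z = {i \<in> {a..<a + int n}. arc i \<in> F}"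
  have finZ: "finite Z" unfolding Z_def by (rule finite_subset[of _ "{a..<a + int n}"]) auto
  have hits: "hits F = card Z" unfolding Z_def by (rule hits_window)
  have neq: "arc c \<noteq> arc d" if "c \<in> Z" "d \<in> Z" "c \<noteq> d" for c d
    using arc_eq_windowD[of c d a] that unfolding Z_def by blast
  have aZ: "a \<in> Z" and bZ: "b \<in> Z" using F b n_gt k_pos by (auto simp: Z_def)
  have trZ: "arc x \<inter> arc z = {}" if "x \<in> Z" "y \<in> Z" "z \<in> Z" "x \<noteq> z"
    "arc x \<inter> arc y = {}" "arc y \<inter> arc z = {}" for x y z
    using disjoint_transD[OF tr, of x y z] neq[of x z] that by (auto simp: Z_def)
  have dZ: "arc c \<inter> arc d = {} \<longleftrightarrow> int k \<le> d - c \<and> d - c \<le> int n - int k"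
    if "c \<in> Z" "d \<in> Z" "c \<le> d" for c d
    using disjoint_arc_iff[of c d] that by (auto simp: Z_def)
  show ?thesis
  proof (cases "\<exists>d\<in>Z. d \<noteq> a \<and> d \<noteq> b \<and> arc d \<inter> arc a = {}")
    case True
    then obtain d where d: "d \<in> Z" "d \<noteq> a" "d \<noteq> b" "arc d \<inter> arc a = {}" by blast
    have db: "arc d \<inter> arc b = {}" using trZ[OF d(1) aZ bZ d(3,4) dis] .
    define lo where "lo = min b d"
    define hi where "hi = max b d"
    have lo: "lo \<in> Z" "arc lo \<inter> arc a = {}" and hi: "hi \<in> Z" "arc hi \<inter> arc a = {}"
      and lohi: "arc lo \<inter> arc hi = {}" "lo \<le> hi"
      using d db bZ dis by (auto simp: lo_def hi_def min_def max_def Int_commute)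
    have "arc a \<inter> arc lo = {}" "arc a \<inter> arc hi = {}" using lo hi by (auto simp: Int_commute)
    then have bnd: "a + int k \<le> lo" "lo + int k \<le> hi" "hi \<le> a + int n - int k"
      using dZ[OF aZ lo(1)] dZ[OF aZ hi(1)] dZ[OF lo(1) hi(1) lohi(2)] lohi lo(1) hi(1)
      by (auto simp: Z_def)
    \<comment> \<open>By transitivity an arc that meets \<open>arc a\<close> also meets
      \<open>arc lo\<close> and \<open>arc hi\<close>, but an arc of length \<open>k\<close> cannot
      meet three pairwise disjoint arcs of length \<open>k\<close>.\<close>
    have all: "arc c \<inter> arc a = {}" if c: "c \<in> Z" "c \<noteq> a" for c
    proof (rule ccontr)
      assume meet: "arc c \<inter> arc a \<noteq> {}"
      have cw: "a < c" "c < a + int n" using c by (auto simp: Z_def)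
      have "arc c \<inter> arc lo \<noteq> {}" using trZ[OF c(1) lo(1) aZ c(2) _ lo(2)] meet by blast
      moreover have "arc c \<inter> arc hi \<noteq> {}" using trZ[OF c(1) hi(1) aZ c(2) _ hi(2)] meet by blast
      moreover have "c - a < int k \<or> int n - int k < c - a"
        using dZ[OF aZ c(1)] meet cw by (auto simp: Int_commute)
      ultimately show False
        using dZ[OF c(1) hi(1)] dZ[OF lo(1) c(1)] bnd cw k_pos by (auto simp: Int_commute)
    qed
    have "card (arc ` Z) \<le> k"
    proof (rule cl)
      show "arc ` Z \<subseteq> F" by (auto simp: Z_def)
      fix A B assume "A \<in> arc ` Z" "B \<in> arc ` Z" "A \<noteq> B"
      then obtain x y where xy: "x \<in> Z" "y \<in> Z" "x \<noteq> y" "A = arc x" "B = arc y" by blast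
      show "A \<inter> B = {}"
      proof (cases "x = a \<or> y = a")
        case True
        then show ?thesis using all[of x] all[of y] xy by (auto simp: Int_commute)
      next
        case False
        then show ?thesis using trZ[OF xy(1) aZ xy(2,3)] all[of x] all[of y] xy
          by (simp add: Int_commute)
      qed
    qed
    moreover have "card (arc ` Z) = card Z" using neq by (intro card_image inj_onI) blast
    ultimately show ?thesis using hits by simp
  next
    case False
    have meet: "arc c \<inter> arc a \<noteq> {}" "arc c \<inter> arc b \<noteq> {}" if "c \<in> Z" "c \<noteq> a" "c \<noteq> b" for c
    proof -
      show *: "arc c \<inter> arc a \<noteq> {}" using False that by blast
      show "arc c \<inter> arc b \<noteq> {}" using trZ[OF that(1) bZ aZ that(2)] * dis by (auto simp: Int_commute)
    qed
    define S where "S = {c \<in> Z. a < c \<and> c < b}"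
    define Q where "Q = {c \<in> Z. b < c}"
    have S: "S \<subseteq> {b - int k + 1..a + int k - 1}"
    proof
      fix c assume "c \<in> S"
      then have c: "c \<in> Z" "a < c" "c < b" by (auto simp: S_def)
      show "c \<in> {b - int k + 1..a + int k - 1}"
        using meet[of c] dZ[OF aZ c(1)] dZ[OF c(1) bZ] c b k_pos by (auto simp: Int_commute)
    qed
    have Q: "Q \<subseteq> {a + int n - int k + 1..b + int k - 1}"
    proof
      fix c assume "c \<in> Q"
      then have c: "c \<in> Z" "b < c" "c < a + int n" by (auto simp: Q_def Z_def)
      show "c \<in> {a + int n - int k + 1..b + int k - 1}"
        using meet[of c] dZ[OF aZ c(1)] dZ[OF bZ c(1)] c b k_pos by (auto simp: Int_commute)
    qed
    have fin: "finite S" "finite Q" using finZ by (auto simp: S_def Q_def)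
    have ZSQ: "Z = {a, b} \<union> S \<union> Q" using aZ bZ unfolding S_def Q_def Z_def by auto
    have "card Z \<le> card {a, b} + card S + card Q"
      unfolding ZSQ using card_Un_le[of "{a, b} \<union> S" Q] card_Un_le[of "{a, b}" S] by linarith
    moreover have "card {a, b} \<le> 2" by (simp add: card_insert_if)
    ultimately have le: "hits F \<le> 2 + card S + card Q" using hits by linarith
    have Sc: "card S \<le> nat (2 * int k - 1 - (b - a))"
      using card_mono[OF _ S] by (simp add: algebra_simps)
    have Qc: "card Q \<le> nat (2 * int k - 1 - (a + int n - b))"
      using card_mono[OF _ Q] by (simp add: algebra_simps)
    consider "S \<noteq> {}" "Q \<noteq> {}" | "Q = {}" | "S = {}" by blast
    then show ?thesis
    proof cases
      case 1
      \<comment> \<open>\<open>n \<ge> 3 * k - 1\<close> makes arcs from opposite gaps disjoint. By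
        transitivity two points of one gap would then start disjoint arcs, for which they are too
        close; so each gap holds one point, and \<open>4 \<le> k\<close> suffices.\<close>
      have SQ: "arc c \<inter> arc q = {}" if "c \<in> S" "q \<in> Q" for c q
      proof -
        have "c \<in> {b - int k + 1..a + int k - 1}" "q \<in> {a + int n - int k + 1..b + int k - 1}"
          using S Q that by auto
        then show ?thesis
          using dZ[of c q] that n n_gt unfolding S_def Q_def by auto
      qed
      have "card S \<le> 1"
      proof (rule card_le_1_if_all_eq, rule ccontr)
        fix x y assume xy: "x \<in> S" "y \<in> S" "x \<noteq> y"
        obtain q where q: "q \<in> Q" using 1 by blast
        have dxy: "arc x \<inter> arc y = {}"
          using trZ[of x q y] SQ[OF xy(1) q] SQ[OF xy(2) q] xy q
          by (auto simp: S_def Q_def Int_commute)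
        have "x \<in> {b - int k + 1..a + int k - 1}" "y \<in> {b - int k + 1..a + int k - 1}" 
          using S xy by auto
        then show False
          using dxy dZ[of x y] dZ[of y x] xy b by (cases "x \<le> y") (auto simp: S_def Int_commute)
      qed
      moreover have "card Q \<le> 1"
      proof (rule card_le_1_if_all_eq, rule ccontr)
        fix x y assume xy: "x \<in> Q" "y \<in> Q" "x \<noteq> y"
        obtain q where q: "q \<in> S" using 1 by blast
        have dxy: "arc x \<inter> arc y = {}"
          using trZ[of x q y] SQ[OF q xy(1)] SQ[OF q xy(2)] xy q
          by (auto simp: S_def Q_def Int_commute)
        have "x \<in> {a + int n - int k + 1..b + int k - 1}" "y \<in> {a + int n - int k + 1..b + int k - 1}" 
          using Q xy by auto
        then show False
          using dxy dZ[of x y] dZ[of y x] xy b by (cases "x \<le> y") (auto simp: Q_def Int_commute)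
      qed
      ultimately show ?thesis using le k4 by simp
    next
      case 2
      show ?thesis
      proof (cases "hits F \<le> k")
        case False
        \<comment> \<open>More than \<open>k\<close> hits leave only \<open>b = a + k\<close>, with
          every place of the gap in use, in particular \<open>a + 1\<close>.\<close>
        then have cS: "k - 1 \<le> card S" using le 2 by simp
        then have "int k - 1 \<le> 2 * int k - 1 - (b - a)" using Sc k4 by linarith
        then have ba: "b = a + int k" using b by simp
        have S': "S \<subseteq> {a + 1..a + int k - 1}" using S ba by auto
        moreover have "card S = card {a + 1..a + int k - 1}"
          using cS card_mono[OF _ S'] k4 by simp
        ultimately have "S = {a + 1..a + int k - 1}" by (intro card_subset_eq) auto
        then have "a + 1 \<in> S" using k4 by simp
        then have "arc (a + 1) \<in> F" by (simp add: S_def Z_def)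
        then have "private_pair F (arc a) (arc (a + int k))"
          using tr F k4 ba by (intro private_pair_if_adjacent) auto
        moreover have "hits F \<le> k + 1" using le 2 Sc ba k4 by simp
        ultimately show ?thesis by blast
      qed simp
    next
      case 3
      show ?thesis
      proof (cases "hits F \<le> k")
        case False
        then have cQ: "k - 1 \<le> card Q" using le 3 by simp
        then have "int k - 1 \<le> 2 * int k - 1 - (a + int n - b)" using Qc k4 by linarith
        then have ba: "a + int n = b + int k" using b by simp
        then have arcb: "arc (b + int k) = arc a" using arc_add_period[of a] by simp
        have Q': "Q \<subseteq> {b + 1..b + int k - 1}" using Q ba by auto
        moreover have "card Q = card {b + 1..b + int k - 1}"
          using cQ card_mono[OF _ Q'] k4 by simp
        ultimately have "Q = {b + 1..b + int k - 1}" by (intro card_subset_eq) auto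
        then have "b + 1 \<in> Q" using k4 by simp
        then have "arc (b + 1) \<in> F" by (simp add: Q_def Z_def)
        then have "private_pair F (arc b) (arc (b + int k))"
          using tr F k4 arcb by (intro private_pair_if_adjacent) auto
        moreover have "hits F \<le> k + 1" using le 3 Qc ba k4 by simp
        ultimately show ?thesis by blast
      qed simp
    qed
  qed
qed

text \<open>Any other arc from \<open>F\<close> must meet both \<open>arc a\<close> and
  \<open>B\<close>. Shifting \<open>arc a\<close> by one place adds just a neighbour, which lies
  outside \<open>B\<close>, so \<open>a - 1\<close> and \<open>a + 1\<close> are ruled out. The rest
  is Katona's pairing with transitivity in place of intersection.\<close>

lemma hits_less_if_private:
  assumes tr: "disjoint_trans F" and pr: "private_pair F (arc a) B"
    and nb: "f (a - 1) \<notin> B" "f (a + int k) \<notin> B" and no_arc: "\<And>i. arc i \<noteq> B"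
    and k4: "4 \<le> k" and n: "3 * k \<le> n + 2"
  shows "hits F \<le> k - 1"
proof -
  define p where "p = a - int k + 1"
  define Z where "Z = {i \<in> {p..<p + int n}. arc i \<in> F}"
  have hits: "hits F = card Z" unfolding Z_def by (rule hits_window)
  have neq: "arc c \<noteq> arc d" if "c \<in> Z" "d \<in> Z" "c \<noteq> d" for c d
    using arc_eq_windowD[of c d p] that unfolding Z_def by blast
  have aF: "arc a \<in> F" and dB: "arc a \<inter> B = {}"
    and prD: "\<And>C. C \<in> F \<Longrightarrow> C \<noteq> arc a \<Longrightarrow> C \<noteq> B \<Longrightarrow> C \<inter> arc a \<noteq> {} \<and> C \<inter> B \<noteq> {}"
    using pr unfolding private_pair_def by auto
  have aZ: "a \<in> Z" using aF k_pos n_gt by (auto simp: Z_def p_def)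
  have meet: "arc c \<inter> arc a \<noteq> {}" "arc c \<inter> B \<noteq> {}" if "c \<in> Z" "c \<noteq> a" for c
    using prD[of "arc c"] neq[OF that(1) aZ that(2)] no_arc that by (auto simp: Z_def)
  have dZ: "arc c \<inter> arc d = {} \<longleftrightarrow> int k \<le> d - c \<and> d - c \<le> int n - int k"
    if "c \<in> Z" "d \<in> Z" "c \<le> d" for c d
    using disjoint_arc_iff[of c d] that by (auto simp: Z_def)
  have trZ: "x = z" if "x \<in> Z" "y \<in> Z" "z \<in> Z"
    "arc x \<inter> arc y = {}" "arc y \<inter> arc z = {}" "arc x \<inter> arc z \<noteq> {}" for x y z
    using disjoint_transD[OF tr, of x y z] neq[of x z] that by (auto simp: Z_def)
  have right: "a + 1 \<notin> Z"
  proof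
    assume Z: "a + 1 \<in> Z"
    have "{a + 1..<a + 1 + int k} \<subseteq> {a..<a + int k} \<union> {a + int k}" by auto
    then have "arc (a + 1) \<subseteq> arc a \<union> {f (a + int k)}" unfolding arc_def by blast
    then show False using meet(2)[OF Z] dB nb by auto
  qed
  have left: "a - 1 \<notin> Z"
  proof
    assume Z: "a - 1 \<in> Z"
    have "{a - 1..<a - 1 + int k} \<subseteq> {a..<a + int k} \<union> {a - 1}" by auto
    then have "arc (a - 1) \<subseteq> arc a \<union> {f (a - 1)}" unfolding arc_def by blast
    then show False using meet(2)[OF Z] dB nb by auto
  qed
  \<comment> \<open>Points of \<open>R\<close> are shifted by \<open>- k\<close>, so that
    \<open>x \<in> L\<close> and \<open>y \<in> R\<close> stand for disjoint arcs when
    \<open>x \<le> y\<close>.\<close>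
  define L where "L = {c \<in> Z. c < a}"
  define R where "R = {c. c + int k \<in> Z \<and> a < c + int k}"
  have L: "L \<subseteq> {a - int k + 1..a - 2}"
  proof
    fix c assume "c \<in> L"
    moreover from this have "c \<noteq> a - 1" using left by (auto simp: L_def)
    ultimately show "c \<in> {a - int k + 1..a - 2}" by (auto simp: L_def Z_def p_def)
  qed
  have R: "R \<subseteq> {a - int k + 2..a - 1}"
  proof
    fix c assume "c \<in> R"
    then have c: "c + int k \<in> Z" "a < c + int k" by (auto simp: R_def)
    then have "c + int k \<noteq> a + 1" using right by auto
    moreover have "c + int k < a + int k"
      using meet(1)[OF c(1)] dZ[OF aZ c(1)] c by (auto simp: Z_def p_def Int_commute)
    ultimately show "c \<in> {a - int k + 2..a - 1}" using c by auto
  qed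
  have fin: "finite L" "finite R" using finite_subset[OF L] finite_subset[OF R] by auto
  have "Z = insert a (L \<union> (\<lambda>c. c + int k) ` R)"
  proof (intro set_eqI iffI)
    fix c assume c: "c \<in> Z"
    consider "c < a" | "c = a" | "a < c" by linarith
    then show "c \<in> insert a (L \<union> (\<lambda>c. c + int k) ` R)"
    proof cases
      case 3
      then have "c - int k \<in> R" using c by (simp add: R_def)
      then have "c \<in> (\<lambda>c. c + int k) ` R" by (rule rev_image_eqI) simp
      then show ?thesis by simp
    qed (use c in \<open>auto simp: L_def\<close>)
  qed (use aZ in \<open>auto simp: L_def R_def\<close>)
  then have "card Z \<le> Suc (card (L \<union> (\<lambda>c. c + int k) ` R))"
    using fin by (simp add: card_insert_if)
  also have "card (L \<union> (\<lambda>c. c + int k) ` R) \<le> card L + card ((\<lambda>c. c + int k) ` R)"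
    by (rule card_Un_le)
  also have "card ((\<lambda>c. c + int k) ` R) = card R" by (rule card_image) (auto simp: inj_on_def)
  finally have le: "hits F \<le> Suc (card L + card R)" using hits by simp
  have LR: "arc x \<inter> arc (y + int k) = {}" if "x \<in> L" "y \<in> R" "x \<le> y" for x y
  proof -
    have "x \<in> {a - int k + 1..a - 2}" "y \<in> {a - int k + 2..a - 1}" using L R that by auto
    then show ?thesis using dZ[of x "y + int k"] that n n_gt by (auto simp: L_def R_def)
  qed
  have LL: "x = x'" if "x \<in> L" "x' \<in> L" "y \<in> R" "x \<le> y" "x' \<le> y" for x x' y
  proof -
    have "x \<in> {a - int k + 1..a - 2}" "x' \<in> {a - int k + 1..a - 2}" using L that by auto
    then have "arc x \<inter> arc x' \<noteq> {}"
      using dZ[of x x'] dZ[of x' x] that by (cases "x \<le> x'") (auto simp: L_def Int_commute)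
    then show ?thesis
      using trZ[of x "y + int k" x'] LR[OF that(1,3,4)] LR[OF that(2,3,5)] that
      by (auto simp: L_def R_def Int_commute)
  qed
  have RR: "y = y'" if "x \<in> L" "y \<in> R" "y' \<in> R" "x \<le> y" "x \<le> y'" for x y y'
  proof -
    have "y \<in> {a - int k + 2..a - 1}" "y' \<in> {a - int k + 2..a - 1}" using R that by auto
    then have "arc (y + int k) \<inter> arc (y' + int k) \<noteq> {}"
      using dZ[of "y + int k" "y' + int k"] dZ[of "y' + int k" "y + int k"] that
      by (cases "y \<le> y'") (auto simp: R_def Int_commute)
    then show ?thesis
      using trZ[of "y + int k" x "y' + int k"] LR[OF that(1,2,4)] LR[OF that(1,3,5)] that
      by (auto simp: L_def R_def Int_commute)
  qed
  have "card L + card R \<le> k - 2"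
  proof (cases "L = {} \<or> R = {}")
    case True
    then show ?thesis using card_mono[OF _ L] card_mono[OF _ R] k4 by auto
  next
    case False
    define x where "x = Min L"
    define y where "y = Max R"
    have x: "x \<in> L" "\<And>c. c \<in> L \<Longrightarrow> x \<le> c" using fin False by (auto simp: x_def)
    have y: "y \<in> R" "\<And>c. c \<in> R \<Longrightarrow> c \<le> y" using fin False by (auto simp: y_def)
    have xb: "a - int k + 1 \<le> x" "x \<le> a - 2" using L x(1) by auto
    have yb: "a - int k + 2 \<le> y" "y \<le> a - 1" using R y(1) by auto
    show ?thesis
    proof (cases "x \<le> y")
      case True
      \<comment> \<open>By \<open>LL\<close> and \<open>RR\<close>, \<open>x\<close> is the only
        point of \<open>L\<close> up to \<open>y\<close>, and \<open>y\<close> the only point of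
        \<open>R\<close> from \<open>x\<close> on. The two intervals left for the other points
        together hold at most \<open>k - 4\<close> places.\<close>
      have "L - {x} \<subseteq> {y + 1..a - 2}"
      proof
        fix c assume c: "c \<in> L - {x}"
        then have "y < c" using LL[OF _ x(1) y(1) _ True, of c] by force
        then show "c \<in> {y + 1..a - 2}" using L c by auto
      qed
      then have "card (L - {x}) \<le> nat (a - 2 - y)" using card_mono[of "{y + 1..a - 2}" "L - {x}"] by simp
      moreover have "R - {y} \<subseteq> {a - int k + 2..x - 1}"
      proof
        fix c assume c: "c \<in> R - {y}"
        then have "c < x" using RR[OF x(1) _ y(1) _ True, of c] by force
        then show "c \<in> {a - int k + 2..x - 1}" using R c by auto
      qed
      then have "card (R - {y}) \<le> nat (x - a + int k - 2)"
        using card_mono[of "{a - int k + 2..x - 1}" "R - {y}"] by (simp add: algebra_simps)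
      moreover have "card L = Suc (card (L - {x}))" "card R = Suc (card (R - {y}))"
        using card_Suc_Diff1[OF fin(1) x(1)] card_Suc_Diff1[OF fin(2) y(1)] by simp_all
      ultimately show ?thesis using True xb yb k4 by linarith
    next
      case False
      \<comment> \<open>Here all of \<open>R\<close> precedes all of \<open>L\<close>, so the two
        are disjoint subsets of an interval of \<open>k - 3\<close> places.\<close>
      have "L \<union> R \<subseteq> {a - int k + 2..a - 2}"
      proof
        fix c assume "c \<in> L \<union> R"
        then show "c \<in> {a - int k + 2..a - 2}"
        proof
          assume "c \<in> L"
          then show ?thesis using x(2)[of c] False L yb by auto
        next
          assume "c \<in> R"
          then show ?thesis using y(2)[of c] False R xb by auto
        qed
      qed
      then have "card (L \<union> R) \<le> card {a - int k + 2..a - 2}" by (intro card_mono) auto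
      moreover have "L \<inter> R = {}" using x(2) y(2) False by force
      then have "card (L \<union> R) = card L + card R" using fin by (simp add: card_Un_disjoint)
      ultimately show ?thesis using k4 by simp
    qed
  qed
  then show ?thesis using le k4 by linarith
qed

end

section \<open>Averaging over permutations\<close>

lemma ex_permutes_image:
  assumes "finite U" and "X \<subseteq> U" "Y \<subseteq> U" "A \<subseteq> U" "B \<subseteq> U"
    and "X \<inter> Y = {}" "A \<inter> B = {}" and "card X = card A" "card Y = card B"
  obtains \<tau> where "\<tau> permutes U" "\<tau> ` X = A" "\<tau> ` Y = B"
proof -
  have fin: "finite X" "finite Y" "finite A" "finite B"
    using assms(1-5) by (simp_all add: finite_subset)
  have "card (U - (X \<union> Y)) = card (U - (A \<union> B))"
    using assms fin by (simp add: card_Diff_subset card_Un_disjoint)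
  then obtain h3 where h3: "bij_betw h3 (U - (X \<union> Y)) (U - (A \<union> B))"
    using assms(1) by (metis finite_Diff finite_same_card_bij)
  obtain h1 where h1: "bij_betw h1 X A" using fin assms finite_same_card_bij by blast
  obtain h2 where h2: "bij_betw h2 Y B" using fin assms finite_same_card_bij by blast
  define \<tau> where "\<tau> x = (if x \<in> X then h1 x else if x \<in> Y then h2 x else if x \<in> U then h3 x else x)" for x
  have t1: "bij_betw \<tau> X A" using h1 by (rule bij_betw_cong[THEN iffD1, rotated]) (simp add: \<tau>_def)
  have t2: "bij_betw \<tau> Y B" using h2
    by (rule bij_betw_cong[THEN iffD1, rotated]) (use assms(6) in \<open>auto simp: \<tau>_def\<close>)
  have t3: "bij_betw \<tau> (U - (X \<union> Y)) (U - (A \<union> B))" using h3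
    by (rule bij_betw_cong[THEN iffD1, rotated]) (auto simp: \<tau>_def)
  have "bij_betw \<tau> (X \<union> Y) (A \<union> B)" by (rule bij_betw_combine[OF t1 t2 assms(7)])
  then have "bij_betw \<tau> ((X \<union> Y) \<union> (U - (X \<union> Y))) ((A \<union> B) \<union> (U - (A \<union> B)))"
    by (rule bij_betw_combine[OF _ t3]) auto
  moreover have "(X \<union> Y) \<union> (U - (X \<union> Y)) = U" "(A \<union> B) \<union> (U - (A \<union> B)) = U" using assms by auto
  ultimately have "bij_betw \<tau> U U" by simp
  then have "\<tau> permutes U" by (rule bij_imp_permutes) (use assms in \<open>auto simp: \<tau>_def\<close>)
  then show thesis using that t1 t2 by (simp add: bij_betw_def)
qed

text \<open>Composing on both sides with fixed permutations that match up the position sets and the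
  value sets is injective; hence the count depends on cardinalities alone.\<close>

lemma card_permutes_image_le:
  assumes "finite U" and "X \<subseteq> U" "Y \<subseteq> U" "A \<subseteq> U" "B \<subseteq> U" and "X \<inter> Y = {}" "A \<inter> B = {}"
    and "X' \<subseteq> U" "Y' \<subseteq> U" "A' \<subseteq> U" "B' \<subseteq> U" and "X' \<inter> Y' = {}" "A' \<inter> B' = {}"
    and "card X = card X'" "card Y = card Y'" "card A = card A'" "card B = card B'"
  shows "card {\<pi>. \<pi> permutes U \<and> \<pi> ` X = A \<and> \<pi> ` Y = B}
    \<le> card {\<pi>. \<pi> permutes U \<and> \<pi> ` X' = A' \<and> \<pi> ` Y' = B'}"
proof -
  obtain \<sigma> where \<sigma>: "\<sigma> permutes U" "\<sigma> ` X' = X" "\<sigma> ` Y' = Y"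
    by (rule ex_permutes_image[of U X' Y' X Y]) (use assms in auto)
  obtain \<tau> where \<tau>: "\<tau> permutes U" "\<tau> ` A = A'" "\<tau> ` B = B'"
    by (rule ex_permutes_image[of U A B A' B']) (use assms in auto)
  show ?thesis
  proof (rule card_inj_on_le[where f = "\<lambda>\<pi>. \<tau> \<circ> \<pi> \<circ> \<sigma>"])
    show "inj_on (\<lambda>\<pi>. \<tau> \<circ> \<pi> \<circ> \<sigma>) {\<pi>. \<pi> permutes U \<and> \<pi> ` X = A \<and> \<pi> ` Y = B}"
    proof (rule inj_onI)
      fix p q assume "\<tau> \<circ> p \<circ> \<sigma> = \<tau> \<circ> q \<circ> \<sigma>"
      then have eq: "\<tau> (p (\<sigma> x)) = \<tau> (q (\<sigma> x))" for x by (metis comp_apply)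
      show "p = q"
      proof
        fix y
        obtain x where "y = \<sigma> x" using permutes_surj[OF \<sigma>(1)] by (rule surjE)
        then show "p y = q y" using eq[of x] permutes_inj[OF \<tau>(1)] by (simp add: inj_eq)
      qed
    qed
    show "(\<lambda>\<pi>. \<tau> \<circ> \<pi> \<circ> \<sigma>) ` {\<pi>. \<pi> permutes U \<and> \<pi> ` X = A \<and> \<pi> ` Y = B}
      \<subseteq> {\<pi>. \<pi> permutes U \<and> \<pi> ` X' = A' \<and> \<pi> ` Y' = B'}"
      using \<sigma> \<tau> by (auto simp: permutes_compose image_comp[symmetric])
    show "finite {\<pi>. \<pi> permutes U \<and> \<pi> ` X' = A' \<and> \<pi> ` Y' = B'}"
      using finite_permutations[OF assms(1)] by (rule rev_finite_subset) auto
  qed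
qed

lemma card_permutes_image_eq:
  assumes "finite U" and "X \<subseteq> U" "Y \<subseteq> U" "A \<subseteq> U" "B \<subseteq> U" and "X \<inter> Y = {}" "A \<inter> B = {}"
    and "X' \<subseteq> U" "Y' \<subseteq> U" "A' \<subseteq> U" "B' \<subseteq> U" and "X' \<inter> Y' = {}" "A' \<inter> B' = {}"
    and "card X = card X'" "card Y = card Y'" "card A = card A'" "card B = card B'"
  shows "card {\<pi>. \<pi> permutes U \<and> \<pi> ` X = A \<and> \<pi> ` Y = B}
    = card {\<pi>. \<pi> permutes U \<and> \<pi> ` X' = A' \<and> \<pi> ` Y' = B'}"
  using card_permutes_image_le[of U X Y A B X' Y' A' B'] card_permutes_image_le[of U X' Y' A' B' X Y A B]
    assms by simp

lemma le_binomial: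
  assumes "1 \<le> k" "k < m"
  shows "m \<le> m choose k"
  using assms
proof (induction m arbitrary: k)
  case (Suc m)
  show ?case
  proof (cases "k = m")
    case True
    then show ?thesis by simp
  next
    case False
    then have *: "m \<le> m choose k" using Suc by simp
    obtain j where j: "k = Suc j" using Suc.prems by (cases k) auto
    then have "0 < m choose j" using Suc.prems by simp
    then show ?thesis using * unfolding j binomial_Suc_Suc by linarith
  qed
qed simp

context kneser
begin

section \<open>Cyclic orders given by permutations\<close>

definition pos :: "int \<Rightarrow> nat" where "pos i = Suc (nat (i mod int n))"

text \<open>Arcs of the standard cyclic order; those of the order \<open>\<pi> \<circ> pos\<close>
  are their images under \<open>\<pi>\<close>.\<close>

definition block :: "int \<Rightarrow> nat set" where "block i = pos ` {i..<i + int k}"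

definition perms :: "(nat \<Rightarrow> nat) set" where "perms = {\<pi>. \<pi> permutes {1..n}}"

lemma finite_perms: "finite perms" by (simp add: perms_def finite_permutations)

lemma card_perms: "card perms = fact n" by (simp add: perms_def card_permutations)

lemma inj_perm: "\<pi> \<in> perms \<Longrightarrow> inj \<pi>" by (auto simp: perms_def permutes_inj)

lemma pos_in: "pos i \<in> {1..n}"
proof -
  have "0 \<le> i mod int n" "i mod int n < int n" using n_ge by auto
  then show ?thesis by (simp add: pos_def nat_less_iff Suc_le_eq)
qed

lemma pos_eq_iff: "pos i = pos j \<longleftrightarrow> int n dvd i - j"
  using n_ge by (simp add: pos_def eq_nat_nat_iff mod_eq_dvd_iff)

lemma circular_word: "\<pi> \<in> perms \<Longrightarrow> circular_word n k (\<pi> \<circ> pos)"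
  using n_ge k_pos by unfold_locales (auto simp: pos_eq_iff inj_eq[OF inj_perm])

lemma id_in_perms: "id \<in> perms" by (simp add: perms_def permutes_id)

lemma arc_eq: "\<pi> \<in> perms \<Longrightarrow> circular_word.arc k (\<pi> \<circ> pos) i = \<pi> ` block i"
  by (simp add: circular_word.arc_def[OF circular_word] block_def image_comp)

definition hits :: "(nat \<Rightarrow> nat) \<Rightarrow> nat set set \<Rightarrow> nat" where
  "hits \<pi> F = card {i \<in> {0..<int n}. \<pi> ` block i \<in> F}"

lemma hits_eq: "\<pi> \<in> perms \<Longrightarrow> circular_word.hits n k (\<pi> \<circ> pos) F = hits \<pi> F"
  by (simp add: circular_word.hits_def[OF circular_word] hits_def arc_eq)

interpretation blk: circular_word n k pos
  rewrites "circular_word.arc k pos = block"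
  using circular_word[OF id_in_perms] arc_eq[OF id_in_perms] by (auto simp: fun_eq_iff)

lemma block_in_V: "block i \<in> V"
  using blk.card_arc[of i] pos_in by (auto simp: V_def block_def)

text \<open>Double counting: each of the \<open>n\<close> blocks is carried onto each set in
  \<open>V\<close> by the same number of permutations, namely \<open>fact n\<close> divided by
  \<open>n choose k\<close>. The factor \<open>n choose k\<close> keeps the equation in the natural
  numbers.\<close>

lemma sum_hits:
  assumes F: "F \<subseteq> V"
  shows "(\<Sum>\<pi>\<in>perms. hits \<pi> F) * (n choose k) = n * card F * fact n"
proof -
  \<comment> \<open>The empty set as second component reduces the count for pairs to one for single
    sets.\<close>
  define N where "N = card {\<pi>. \<pi> permutes {1..n} \<and> \<pi> ` block 0 = block 0 \<and> \<pi> ` {} = {}}"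
  have cnt: "card {\<pi> \<in> perms. \<pi> ` block i = A} = N" if "A \<in> V" for A i
  proof -
    have "card {\<pi>. \<pi> permutes {1..n} \<and> \<pi> ` block i = A \<and> \<pi> ` {} = {}} = N"
      unfolding N_def
      using that V_D[OF that] V_D[OF block_in_V[of i]] V_D[OF block_in_V[of 0]]
      by (intro card_permutes_image_eq) auto
    then show ?thesis by (simp add: perms_def)
  qed
  have finF: "finite F" using F finite_V finite_subset by blast
  have "(\<Sum>\<pi>\<in>perms. card {i \<in> {0..<int n}. \<pi> ` block i \<in> F})
      = (\<Sum>i\<in>{0..<int n}. card F * N)"
  proof (rule sum_multicount_gen)
    show "\<forall>i\<in>{0..<int n}. card {\<pi> \<in> perms. \<pi> ` block i \<in> F} = card F * N"
    proof
      fix i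
      have "{\<pi> \<in> perms. \<pi> ` block i \<in> F} = (\<Union>A\<in>F. {\<pi> \<in> perms. \<pi> ` block i = A})" by auto
      also have "card \<dots> = (\<Sum>A\<in>F. card {\<pi> \<in> perms. \<pi> ` block i = A})"
        using finF finite_perms by (intro card_UN_disjoint) auto
      also have "\<dots> = card F * N" using cnt F by (simp add: subset_iff)
      finally show "card {\<pi> \<in> perms. \<pi> ` block i \<in> F} = card F * N" .
    qed
  qed (use finite_perms in auto)
  then have s: "(\<Sum>\<pi>\<in>perms. hits \<pi> F) = n * card F * N" by (simp add: hits_def)
  have "perms = (\<Union>A\<in>V. {\<pi> \<in> perms. \<pi> ` block 0 = A})"
  proof -
    have "\<pi> ` block 0 \<in> V" if "\<pi> \<in> perms" for \<pi>
      using that V_D[OF block_in_V[of 0]] card_image[OF inj_on_subset[OF inj_perm[OF that]]]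
        permutes_image[of \<pi> "{1..n}"] by (fastforce simp: V_def perms_def)
    then show ?thesis by auto
  qed
  then have "fact n = card (\<Union>A\<in>V. {\<pi> \<in> perms. \<pi> ` block 0 = A})"
    using card_perms by simp
  also have "\<dots> = (\<Sum>A\<in>V. card {\<pi> \<in> perms. \<pi> ` block 0 = A})"
    using finite_V finite_perms by (intro card_UN_disjoint) auto
  also have "\<dots> = (n choose k) * N" using cnt n_subsets[of "{1..n}" k] by (simp add: V_def)
  finally show ?thesis using s by simp
qed

text \<open>By \<open>k * (n choose k) = n * ((n - 1) choose (k - 1))\<close>, an average of
  \<open>k\<close> hits corresponds exactly to the size of a star.\<close>

lemma card_le_if_sum_hits:
  assumes F: "F \<subseteq> V"
  shows "(\<Sum>\<pi>\<in>perms. hits \<pi> F) \<le> k * fact n \<Longrightarrow> card F \<le> (n - 1) choose (k - 1)"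
    and "(\<Sum>\<pi>\<in>perms. hits \<pi> F) < k * fact n \<Longrightarrow> card F < (n - 1) choose (k - 1)"
proof -
  have ch: "k * (n choose k) = n * ((n - 1) choose (k - 1))"
    using times_binomial_minus1_eq[of k n] k_pos by simp
  have c0: "0 < n choose k" using n_ge by simp
  show "card F \<le> (n - 1) choose (k - 1)" if "(\<Sum>\<pi>\<in>perms. hits \<pi> F) \<le> k * fact n"
  proof -
    have "n * card F * fact n \<le> k * fact n * (n choose k)"
      unfolding sum_hits[OF F, symmetric] using that by (rule mult_le_mono1)
    also have "\<dots> = n * ((n - 1) choose (k - 1)) * fact n" using ch by (simp add: ac_simps)
    finally show ?thesis using n_ge by simp
  qed
  show "card F < (n - 1) choose (k - 1)" if "(\<Sum>\<pi>\<in>perms. hits \<pi> F) < k * fact n"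
  proof -
    have "n * card F * fact n < k * fact n * (n choose k)"
      unfolding sum_hits[OF F, symmetric] using that c0 by (rule mult_less_mono1)
    also have "\<dots> = n * ((n - 1) choose (k - 1)) * fact n" using ch by (simp add: ac_simps)
    finally show ?thesis by simp
  qed
qed

text \<open>Covers the families for which the hypothesis \<open>cl\<close> of
  \<open>sum_hits_le_if_sparse\<close> can fail: disjointness gives
  \<open>card F * k \<le> n\<close>.\<close>

lemma card_disjoint_family_le:
  assumes F: "F \<subseteq> V" and dis: "\<And>A B. A \<in> F \<Longrightarrow> B \<in> F \<Longrightarrow> A \<noteq> B \<Longrightarrow> A \<inter> B = {}"
    and k: "2 \<le> k"
  shows "card F \<le> (n - 1) choose (k - 1)"
proof -
  have finF: "finite F" using F finite_V finite_subset by blast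
  have "card (\<Union>F) = (\<Sum>A\<in>F. card A)"
    using dis F V_D(3) by (intro card_Union_disjoint) (auto simp: pairwise_def disjnt_def)
  also have "\<dots> = card F * k" using F V_D(2) by (simp add: subset_iff)
  finally have "card F * k = card (\<Union>F)" by simp
  also have "\<dots> \<le> card {1..n}" using F V_D(1) by (intro card_mono) auto
  finally have "card F * k \<le> n" by simp
  moreover have "card F * 2 \<le> card F * k" using k by simp
  moreover have "n - 1 \<le> (n - 1) choose (k - 1)" using k n_ge by (intro le_binomial) auto
  ultimately show ?thesis using n_ge k by linarith
qed

text \<open>A set of \<open>k\<close> elements cannot meet more than \<open>k\<close> pairwise
  disjoint sets, so every member of \<open>F\<close> is disjoint from some other member of
  \<open>D\<close> and thus lies in the same clique of the disjointness graph.\<close>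

lemma all_disjoint_if_many_disjoint:
  assumes F: "F \<subseteq> V" and tr: "disjoint_trans F"
    and D: "D \<subseteq> F" "\<And>A B. A \<in> D \<Longrightarrow> B \<in> D \<Longrightarrow> A \<noteq> B \<Longrightarrow> A \<inter> B = {}" "k < card D"
    and AB: "A \<in> F" "B \<in> F" "A \<noteq> B"
  shows "A \<inter> B = {}"
proof -
  have ex: "\<exists>M\<in>D. M \<noteq> C \<and> C \<inter> M = {}" if C: "C \<in> F" for C
  proof (cases "C \<in> D")
    case True
    have "1 < card D" using D(3) k_pos by simp
    then have "\<not> D \<subseteq> {C}" using card_mono[of "{C}" D] by auto
    then obtain M where "M \<in> D" "M \<noteq> C" by blast
    then show ?thesis using D(2)[OF True] by blast
  next
    case False
    have fC: "finite C" and cC: "card C = k" using V_D C F by auto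
    show ?thesis
    proof (rule ccontr)
      assume no: "\<not> ?thesis"
      have "\<forall>M\<in>D. \<exists>x. x \<in> C \<inter> M"
      proof
        fix M assume "M \<in> D"
        moreover from this have "M \<noteq> C" using False by auto
        ultimately have "C \<inter> M \<noteq> {}" using no by auto
        then show "\<exists>x. x \<in> C \<inter> M" by blast
      qed
      then obtain g where g: "\<And>M. M \<in> D \<Longrightarrow> g M \<in> C \<inter> M" by metis
      have "inj_on g D" using g D(2) by (fastforce simp: inj_on_def)
      then have "card D \<le> card C" using fC g by (intro card_inj_on_le[of g]) auto
      then show False using cC D(3) by simp
    qed
  qed
  obtain M where M: "M \<in> D" "M \<noteq> A" "A \<inter> M = {}" using ex[OF AB(1)] by blast
  obtain N where N: "N \<in> D" "N \<noteq> B" "B \<inter> N = {}" using ex[OF AB(2)] by blast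
  have MN: "M \<in> F" "N \<in> F" using M N D(1) by auto
  have tr': "X \<inter> Z = {}" if "X \<in> F" "Y \<in> F" "Z \<in> F" "X \<noteq> Y" "Y \<noteq> Z" "X \<noteq> Z" "X \<inter> Y = {}" "Y \<inter> Z = {}"
    for X Y Z using tr that unfolding disjoint_trans_def by blast
  show ?thesis
  proof (cases "A = N")
    case True
    then show ?thesis using N by (simp add: Int_commute)
  next
    case False
    have "A \<inter> N = {}"
    proof (cases "M = N")
      case True
      then show ?thesis using M by simp
    next
      case MneN: False
      then have "M \<inter> N = {}" using D(2) M N by blast
      then show ?thesis using tr'[of A M N] AB MN M False MneN by blast
    qed
    then show ?thesis using tr'[of A N B] AB MN N False by (simp add: Int_commute)
  qed
qed

section \<open>Hits in the range n <= 3k - 2\<close>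

lemma hits_le_if_balanced:
  assumes tr: "disjoint_trans F"
    and bal: "\<And>A B C. A \<in> F \<Longrightarrow> B \<in> F \<Longrightarrow> C \<in> F \<Longrightarrow> A \<noteq> B \<Longrightarrow> C \<noteq> A \<Longrightarrow> C \<noteq> B \<Longrightarrow> A \<inter> B = {} \<Longrightarrow>
      card (C \<inter> A) < card (C \<inter> B) + (n - 2 * k)"
    and n: "n + 2 \<le> 3 * k" and \<pi>: "\<pi> \<in> perms"
  shows "hits \<pi> F \<le> k"
proof -
  interpret W: circular_word n k "\<pi> \<circ> pos" by (rule circular_word[OF \<pi>])
  have "W.hits F \<le> k"
  proof (cases "\<exists>a b. W.arc a \<in> F \<and> W.arc b \<in> F \<and> W.arc a \<inter> W.arc b = {}")
    case True
    then obtain a b where "W.arc a \<in> F" "W.arc b \<in> F" "W.arc a \<inter> W.arc b = {}" by blast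
    then have "W.hits F \<le> n - 2 * k + 2"
      by (intro W.hits_le_if_balanced[OF tr _ n, of a b]) (auto intro: bal)
    then show ?thesis using n n_ge by simp
  next
    case False
    then show ?thesis by (intro W.intersecting_hits(1)) blast
  qed
  then show ?thesis using hits_eq[OF \<pi>] by simp
qed

text \<open>Two disjoint members can be made arcs of one cyclic order, which then has at most
  \<open>r + 2 < k\<close> hits. If there are none, the standard order works: \<open>k\<close> hits
  would be consecutive and contradict \<open>mid\<close>.\<close>

lemma ex_hits_less_if_balanced:
  assumes F: "F \<subseteq> V" and tr: "disjoint_trans F"
    and bal: "\<And>A B C. A \<in> F \<Longrightarrow> B \<in> F \<Longrightarrow> C \<in> F \<Longrightarrow> A \<noteq> B \<Longrightarrow> C \<noteq> A \<Longrightarrow> C \<noteq> B \<Longrightarrow> A \<inter> B = {} \<Longrightarrow>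
      card (C \<inter> A) < card (C \<inter> B) + (n - 2 * k)"
    and mid: "\<And>X Y Z. X \<in> F \<Longrightarrow> Y \<in> F \<Longrightarrow> Z \<in> F \<Longrightarrow> Z \<noteq> X \<Longrightarrow> Z \<noteq> Y \<Longrightarrow>
      card (X - Z) \<le> n - 2 * k \<Longrightarrow> card (Z - Y) \<le> n - 2 * k \<Longrightarrow> n - 2 * k < card (X - Y) \<Longrightarrow>
      card (X \<inter> Y) \<le> n - 2 * k"
    and k4: "4 \<le> k" and n: "2 * n + 2 \<le> 5 * k"
  obtains \<pi> where "\<pi> \<in> perms" "hits \<pi> F < k"
proof (cases "\<exists>A\<in>F. \<exists>B\<in>F. A \<inter> B = {}")
  case True
  then obtain A B where AB: "A \<in> F" "B \<in> F" "A \<inter> B = {}" by blast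
  have V: "A \<in> V" "B \<in> V" using AB F by auto
  have "block 0 \<inter> block (int k) = {}" using blk.disjoint_arc_iff[of 0 "int k"] n_ge by simp
  then obtain \<pi> where \<pi>: "\<pi> permutes {1..n}" "\<pi> ` block 0 = A" "\<pi> ` block (int k) = B"
    using ex_permutes_image[of "{1..n}" "block 0" "block (int k)" A B]
      V_D[OF V(1)] V_D[OF V(2)] V_D[OF block_in_V[of 0]] V_D[OF block_in_V[of "int k"]] AB(3)
    by (metis finite_atLeastAtMost)
  have \<pi>P: "\<pi> \<in> perms" using \<pi> by (simp add: perms_def)
  interpret W: circular_word n k "\<pi> \<circ> pos" by (rule circular_word[OF \<pi>P])
  have arcs: "W.arc 0 = A" "W.arc (int k) = B" using \<pi> arc_eq[OF \<pi>P] by auto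
  have n': "n + 2 \<le> 3 * k" using n n_ge by simp
  have "W.hits F \<le> n - 2 * k + 2"
    by (rule W.hits_le_if_balanced[OF tr _ n', of 0 "int k"]) (use AB arcs bal in auto)
  then have "hits \<pi> F < k" using hits_eq[OF \<pi>P] n n_ge k4 by simp
  with \<pi>P show thesis by (rule that)
next
  case False
  have h: "blk.hits F = hits id F" using hits_eq[OF id_in_perms, of F] by simp
  have "blk.hits F \<le> k" using False by (intro blk.intersecting_hits(1)) blast
  moreover have "blk.hits F \<noteq> k"
  proof
    assume "blk.hits F = k"
    then obtain q where q: "\<And>i. i \<in> {q..<q + int k} \<Longrightarrow> block i \<in> F"
      using blk.intersecting_hits(2)[of F] False by blast
    define s where "s = int n - 2 * int k"
    have s: "1 \<le> s" "2 * s + 2 \<le> int k" using n n_ge by (auto simp: s_def)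
    \<comment> \<open>From \<open>?X\<close> one place to \<open>?Z\<close>, then \<open>r\<close>
      places to \<open>?Y\<close>: both differences are at most \<open>r\<close>, the combined one
      is \<open>r + 1\<close>, yet \<open>?X \<inter> ?Y\<close> has \<open>k - r - 1 > r\<close>
      points.\<close>
    let ?X = "block q" and ?Y = "block (q + 1 + s)" and ?Z = "block (q + 1)"
    have mem: "?X \<in> F" "?Y \<in> F" "?Z \<in> F" using s by (auto intro!: q)
    have ne: "?Z \<noteq> ?X" "?Z \<noteq> ?Y"
      using blk.arc_eq_window[of q "q + 1"] blk.arc_eq_window[of "q + 1" "q + 1 + s"] s s_def by auto
    have cd: "card (block i - block j) = k - card (block i \<inter> block j)" for i j
      by (simp add: card_Diff_subset_Int blk.finite_arc blk.card_arc)
    have "int (card (?X \<inter> ?Z)) = int k - 1" "int (card (?Z \<inter> ?Y)) = int k - s"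
      "int (card (?X \<inter> ?Y)) = int k - s - 1"
      using s unfolding s_def by (simp_all add: blk.card_arc_Int)
    then have "card (?X \<inter> ?Z) = k - 1" "card (?Z \<inter> ?Y) = k - (n - 2 * k)"
      "card (?X \<inter> ?Y) = k - (n - 2 * k) - 1"
      using s n_ge by (auto simp: s_def)
    then have c: "card (?X - ?Z) = 1" "card (?Z - ?Y) = n - 2 * k" "card (?X - ?Y) = n - 2 * k + 1"
      and XY: "card (?X \<inter> ?Y) = k - (n - 2 * k) - 1"
      using n n_ge unfolding cd by linarith+
    have "card (?X \<inter> ?Y) \<le> n - 2 * k" by (rule mid[OF mem ne]) (use c n_ge in auto)
    then show False using XY n n_ge by linarith
  qed
  ultimately have "hits id F < k" using h by simp
  with id_in_perms show thesis by (rule that)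
qed

text \<open>Permutations with more than \<open>k\<close> hits and those with fewer are compared through the positions of
  private pairs: every pair of disjoint position sets is mapped onto a given private pair by the
  same number of permutations.\<close>

lemma sum_hits_le_if_sparse:
  assumes F: "F \<subseteq> V" and tr: "disjoint_trans F"
    and cl: "\<And>D. D \<subseteq> F \<Longrightarrow> (\<And>A B. A \<in> D \<Longrightarrow> B \<in> D \<Longrightarrow> A \<noteq> B \<Longrightarrow> A \<inter> B = {}) \<Longrightarrow> card D \<le> k"
    and k4: "4 \<le> k" and n: "3 * k \<le> n + 1"
  shows "(\<Sum>\<pi>\<in>perms. hits \<pi> F) \<le> k * fact n"
proof -
  \<comment> \<open>\<open>w\<close> counts the permutations carrying one pair of disjoint
    \<open>k\<close>-sets to another; it does not depend on either pair.\<close>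
  define w where
    "w = card {\<pi>. \<pi> permutes {1..n} \<and> \<pi> ` block 0 = block 0 \<and> \<pi> ` block (int k) = block (int k)}"
  have w: "card {\<pi> \<in> perms. \<pi> ` X = A \<and> \<pi> ` Y = B} = w"
    if "X \<in> V" "Y \<in> V" "A \<in> V" "B \<in> V" "X \<inter> Y = {}" "A \<inter> B = {}" for X Y A B
  proof -
    have "block 0 \<inter> block (int k) = {}" using blk.disjoint_arc_iff[of 0 "int k"] n_ge by simp
    then show ?thesis
      unfolding w_def perms_def mem_Collect_eq
      using that V_D[OF that(1)] V_D[OF that(2)] V_D[OF that(3)] V_D[OF that(4)]
        V_D[OF block_in_V[of 0]] V_D[OF block_in_V[of "int k"]]
      by (intro card_permutes_image_eq) auto
  qed
  have finF: "finite F" using F finite_V finite_subset by blast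
  define PP where "PP = {(A, B). private_pair F A B}"
  have PP_F: "PP \<subseteq> F \<times> F" by (auto simp: PP_def private_pair_def)
  then have finPP: "finite PP" using finF by (meson finite_SigmaI finite_subset)
  \<comment> \<open>No order has more than \<open>k + 1\<close> hits, so the sum is at most
    \<open>k * fact n + card E - card D\<close>, and it remains to compare \<open>E\<close> with
    \<open>D\<close>.\<close>
  define E where "E = {\<pi> \<in> perms. k < hits \<pi> F}"
  define D where "D = {\<pi> \<in> perms. hits \<pi> F < k}"
  have finED: "finite E" "finite D" using finite_perms by (auto simp: E_def D_def)
  define T where "T = PP \<times> {0..<int n}"
  have finT: "finite T" using finPP by (simp add: T_def)
  have hits_le: "hits \<pi> F \<le> k + (if \<pi> \<in> E then 1 else 0)"
    and E_private: "\<pi> \<in> E \<Longrightarrow> \<exists>i. private_pair F (\<pi> ` block i) (\<pi> ` block (i + int k))"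
    if \<pi>: "\<pi> \<in> perms" for \<pi>
  proof -
    interpret W: circular_word n k "\<pi> \<circ> pos" by (rule circular_word[OF \<pi>])
    have "W.hits F \<le> k \<or> W.hits F \<le> k + 1 \<and> (\<exists>i. private_pair F (W.arc i) (W.arc (i + int k)))"
      by (rule W.hits_le_or_private[OF tr _ k4 n]) (rule cl)
    then have "hits \<pi> F \<le> k \<or> hits \<pi> F \<le> k + 1 \<and>
        (\<exists>i. private_pair F (\<pi> ` block i) (\<pi> ` block (i + int k)))"
      by (simp only: hits_eq[OF \<pi>] arc_eq[OF \<pi>])
    then show "hits \<pi> F \<le> k + (if \<pi> \<in> E then 1 else 0)"
      and "\<pi> \<in> E \<Longrightarrow> \<exists>i. private_pair F (\<pi> ` block i) (\<pi> ` block (i + int k))"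
      using \<pi> by (auto simp: E_def)
  qed
  \<comment> \<open>Every order in \<open>E\<close> shows some private pair as adjacent blocks, at
    one of the \<open>n\<close> positions.\<close>
  have E_le: "card E \<le> card T * w"
  proof -
    let ?M = "\<lambda>((A, B), i). {\<pi> \<in> perms. \<pi> ` block i = A \<and> \<pi> ` block (i + int k) = B}"
    have "E \<subseteq> (\<Union>t\<in>T. ?M t)"
    proof
      fix \<pi> assume "\<pi> \<in> E"
      moreover from this have \<pi>: "\<pi> \<in> perms" by (simp add: E_def)
      ultimately obtain i where i: "private_pair F (\<pi> ` block i) (\<pi> ` block (i + int k))"
        using E_private by blast
      define j where "j = i mod int n"
      have "j \<in> {0..<int n}" using n_ge by (simp add: j_def)
      moreover have "block i = block j" "block (i + int k) = block (j + int k)"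
        by (auto intro!: blk.arc_cong simp: j_def)
      ultimately have "((\<pi> ` block i, \<pi> ` block (i + int k)), j) \<in> T"
        and "\<pi> \<in> ?M ((\<pi> ` block i, \<pi> ` block (i + int k)), j)"
        using i \<pi> by (auto simp: T_def PP_def)
      then show "\<pi> \<in> (\<Union>t\<in>T. ?M t)" by blast
    qed
    then have "card E \<le> card (\<Union>t\<in>T. ?M t)"
      using finT finite_perms by (intro card_mono) auto
    also have "\<dots> \<le> (\<Sum>t\<in>T. card (?M t))" using finT by (rule card_UN_le)
    also have "\<dots> = (\<Sum>t\<in>T. w)"
    proof (rule sum.cong[OF refl])
      fix t assume "t \<in> T"
      then obtain A B i where t: "t = ((A, B), i)" and pr: "private_pair F A B"
        by (auto simp: T_def PP_def)
      have "A \<in> V" "B \<in> V" "A \<inter> B = {}" using pr F by (auto simp: private_pair_def)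
      moreover have "block i \<inter> block (i + int k) = {}"
        using blk.disjoint_arc_iff[of i "i + int k"] n_ge by simp
      ultimately show "card (?M t) = w" using w[OF block_in_V block_in_V] t by simp
    qed
    finally show ?thesis by simp
  qed
  \<comment> \<open>Places for the partner \<open>B\<close> when \<open>A\<close> occupies
    \<open>block i\<close>: they avoid the block and its two neighbours and are not blocks
    themselves, as \<open>hits_less_if_private\<close> demands.\<close>
  define YY where "YY i = {Y. Y \<subseteq> {1..n} - pos ` {i - 1..i + int k} \<and> card Y = k \<and> Y \<notin> range block}" for i
  \<comment> \<open>There are \<open>(n - k - 2) choose k \<ge> n - k - 2\<close> candidates and at
    most \<open>n - 2 * k - 1\<close> blocks among them, which leaves \<open>k - 1\<close>.\<close>
  have YY_ge: "k - 1 \<le> card (YY i)" for i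
  proof -
    let ?O = "{1..n} - pos ` {i - 1..i + int k}"
    have "inj_on pos {i - 1..i + int k}"
      by (rule inj_on_subset[OF blk.inj_on_window[of "i - 1"]]) (use n_ge k_pos in auto)
    then have "card (pos ` {i - 1..i + int k}) = k + 2" by (simp add: card_image)
    moreover have "pos ` {i - 1..i + int k} \<subseteq> {1..n}" using pos_in by blast
    ultimately have O: "card ?O = n - (k + 2)" by (simp add: card_Diff_subset finite_subset)
    have sub: "{Y. Y \<subseteq> ?O \<and> card Y = k} - block ` {i + int k + 1..i + int n - int k - 1} \<subseteq> YY i"
    proof
      fix Y assume Y: "Y \<in> {Y. Y \<subseteq> ?O \<and> card Y = k} - block ` {i + int k + 1..i + int n - int k - 1}"
      have "Y \<noteq> block j" for j
      proof
        assume Yj: "Y = block j"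
        \<comment> \<open>\<open>j\<close> is moved into the period that starts at
          \<open>i - 1\<close>; avoiding the neighbours then bounds \<open>j'\<close> on both
          sides.\<close>
        define j' where "j' = i - 1 + (j - (i - 1)) mod int n"
        have "int n dvd j - j'"
          unfolding j'_def by (metis diff_diff_eq dvd_minus_mod)
        then have Yj': "Y = block j'" using Yj blk.arc_cong by simp
        have w: "i - 1 \<le> j'" "j' < i - 1 + int n" using n_ge by (auto simp: j'_def)
        have "pos j' \<in> Y" using Yj' k_pos by (auto simp: block_def)
        then have 1: "i + int k < j'" using Y w by force
        have 2: "j' + int k \<le> i - 1 + int n"
        proof (rule ccontr)
          assume "\<not> ?thesis"
          then have "pos (i - 1 + int n) \<in> Y" using Yj' w by (auto simp: block_def)
          moreover have "pos (i - 1 + int n) = pos (i - 1)" by (simp add: pos_eq_iff)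
          ultimately show False using Y by auto
        qed
        have "j' \<in> {i + int k + 1..i + int n - int k - 1}" using 1 2 by auto
        then show False using Y Yj' by blast
      qed
      then show "Y \<in> YY i" using Y by (auto simp: YY_def)
    qed
    have fin: "finite (YY i)" unfolding YY_def by (rule finite_subset[of _ "Pow {1..n}"]) auto
    have "n - (k + 2) \<le> (n - (k + 2)) choose k" using k_pos k4 n by (intro le_binomial) auto
    also have "\<dots> = card {Y. Y \<subseteq> ?O \<and> card Y = k}" using n_subsets[of ?O k] O by simp
    also have "\<dots> \<le> card ({Y. Y \<subseteq> ?O \<and> card Y = k} - block ` {i + int k + 1..i + int n - int k - 1})
        + card (block ` {i + int k + 1..i + int n - int k - 1})"
      using diff_card_le_card_Diff[of "block ` {i + int k + 1..i + int n - int k - 1}"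
        "{Y. Y \<subseteq> ?O \<and> card Y = k}"] by simp
    also have "\<dots> \<le> card (YY i) + card {i + int k + 1..i + int n - int k - 1}"
      using sub fin by (intro add_mono card_mono card_image_le) auto
    finally show ?thesis using n k4 by simp
  qed
  define M where "M = (\<lambda>((A, B), i). {\<pi> \<in> perms. \<pi> ` block i = A \<and> (\<exists>Y\<in>YY i. \<pi> ` Y = B)})"
  have M_ge: "(k - 1) * w \<le> card (M t)" if tT: "t \<in> T" for t
  proof -
    obtain A B i where t: "t = ((A, B), i)" and pr: "private_pair F A B"
      using tT by (auto simp: T_def PP_def)
    have AB: "A \<in> V" "B \<in> V" "A \<inter> B = {}" using pr F by (auto simp: private_pair_def)
    have "M t = (\<Union>Y\<in>YY i. {\<pi> \<in> perms. \<pi> ` block i = A \<and> \<pi> ` Y = B})"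
      by (auto simp: M_def t)
    moreover have "card (\<Union>Y\<in>YY i. {\<pi> \<in> perms. \<pi> ` block i = A \<and> \<pi> ` Y = B})
        = (\<Sum>Y\<in>YY i. card {\<pi> \<in> perms. \<pi> ` block i = A \<and> \<pi> ` Y = B})"
    proof (rule card_UN_disjoint)
      show "finite (YY i)" unfolding YY_def by (rule finite_subset[of _ "Pow {1..n}"]) auto
      show "\<forall>Y\<in>YY i. \<forall>Y'\<in>YY i. Y \<noteq> Y' \<longrightarrow> {\<pi> \<in> perms. \<pi> ` block i = A \<and> \<pi> ` Y = B} \<inter>
          {\<pi> \<in> perms. \<pi> ` block i = A \<and> \<pi> ` Y' = B} = {}"
        using inj_perm by (auto simp: inj_image_eq_iff)
    qed (use finite_perms in auto)
    moreover have "card {\<pi> \<in> perms. \<pi> ` block i = A \<and> \<pi> ` Y = B} = w" if Y: "Y \<in> YY i" for Y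
    proof (rule w[OF block_in_V _ AB(1,2) _ AB(3)])
      show "Y \<in> V" using Y by (auto simp: YY_def V_def)
      have "block i \<subseteq> pos ` {i - 1..i + int k}" unfolding block_def by (rule image_mono) auto
      then show "block i \<inter> Y = {}" using Y by (auto simp: YY_def)
    qed
    ultimately have "card (M t) = card (YY i) * w" by simp
    then show ?thesis using YY_ge[of i] by simp
  qed
  have M_D: "M t \<subseteq> D" if "t \<in> T" for t
  proof
    fix \<pi> assume "\<pi> \<in> M t"
    moreover obtain A B i where t: "t = ((A, B), i)" and pr: "private_pair F A B"
      using \<open>t \<in> T\<close> by (auto simp: T_def PP_def)
    ultimately obtain Y where \<pi>: "\<pi> \<in> perms" "\<pi> ` block i = A" "\<pi> ` Y = B" and Y: "Y \<in> YY i"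
      by (auto simp: M_def)
    interpret W: circular_word n k "\<pi> \<circ> pos" by (rule circular_word[OF \<pi>(1)])
    have pY: "pos (i - 1) \<notin> Y" "pos (i + int k) \<notin> Y" using Y by (auto simp: YY_def)
    have "W.hits F \<le> k - 1"
    proof (rule W.hits_less_if_private[OF tr, of i B])
      show "private_pair F (W.arc i) B" using pr \<pi> arc_eq by simp
      show "(\<pi> \<circ> pos) (i - 1) \<notin> B" "(\<pi> \<circ> pos) (i + int k) \<notin> B"
        using pY inj_perm[OF \<pi>(1)] \<pi>(3) by (auto simp: inj_eq)
      show "W.arc j \<noteq> B" for j
      proof -
        have "block j \<noteq> Y" using Y unfolding YY_def by blast
        then show ?thesis
          using inj_perm[OF \<pi>(1)] \<pi>(3) arc_eq[OF \<pi>(1)] by (metis inj_image_eq_iff)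
      qed
    qed (use k4 n in auto)
    then show "\<pi> \<in> D" using \<pi>(1) hits_eq[OF \<pi>(1)] k4 by (simp add: D_def)
  qed
  \<comment> \<open>Each order in \<open>D\<close> lies in \<open>M t\<close> for at most
    \<open>k - 1\<close> indices \<open>t\<close>: the position determines \<open>A\<close>, hence
    its private partner, and at most \<open>k - 1\<close> positions carry a hit. This factor cancels
    against the \<open>k - 1\<close> places in \<open>YY i\<close>.\<close>
  have D_ge: "card T * w \<le> card D"
  proof -
    have "card T * ((k - 1) * w) = (\<Sum>t\<in>T. (k - 1) * w)" by simp
    also have "\<dots> \<le> (\<Sum>t\<in>T. card {\<pi> \<in> D. \<pi> \<in> M t})"
    proof (rule sum_mono)
      fix t assume t: "t \<in> T"
      have "{\<pi> \<in> D. \<pi> \<in> M t} = M t" using M_D[OF t] by blast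
      then show "(k - 1) * w \<le> card {\<pi> \<in> D. \<pi> \<in> M t}" using M_ge[OF t] by simp
    qed
    also have "\<dots> = (\<Sum>\<pi>\<in>D. card {t \<in> T. \<pi> \<in> M t})"
      using finT finED by (intro sum_multicount_gen) auto
    also have "\<dots> \<le> (\<Sum>\<pi>\<in>D. k - 1)"
    proof (rule sum_mono)
      fix \<pi> assume \<pi>: "\<pi> \<in> D"
      have "card {t \<in> T. \<pi> \<in> M t} \<le> card {i \<in> {0..<int n}. \<pi> ` block i \<in> F}"
      proof (rule card_inj_on_le[where f = snd])
        show "inj_on snd {t \<in> T. \<pi> \<in> M t}"
        proof (rule inj_onI)
          fix t t' assume t: "t \<in> {t \<in> T. \<pi> \<in> M t}" "t' \<in> {t \<in> T. \<pi> \<in> M t}" and eq: "snd t = snd t'"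
          obtain A B i where 1: "t = ((A, B), i)" by (metis prod.exhaust)
          obtain A' B' i' where 2: "t' = ((A', B'), i')" by (metis prod.exhaust)
          have "private_pair F A B" "private_pair F A' B'" "A = A'"
            using t eq unfolding 1 2 T_def PP_def M_def by auto
          then show "t = t'" using eq private_pair_unique unfolding 1 2 by auto
        qed
        show "snd ` {t \<in> T. \<pi> \<in> M t} \<subseteq> {i \<in> {0..<int n}. \<pi> ` block i \<in> F}"
          by (auto simp: T_def PP_def M_def private_pair_def)
        show "finite {i \<in> {0..<int n}. \<pi> ` block i \<in> F}"
          by (rule finite_subset[of _ "{0..<int n}"]) auto
      qed
      then show "card {t \<in> T. \<pi> \<in> M t} \<le> k - 1" using \<pi> by (auto simp: D_def hits_def)
    qed
    finally have "(k - 1) * (card T * w) \<le> (k - 1) * card D" by (simp add: ac_simps)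
    then show ?thesis using k4 by simp
  qed
  have "(\<Sum>\<pi>\<in>perms. hits \<pi> F + (if \<pi> \<in> D then 1 else 0)) \<le> (\<Sum>\<pi>\<in>perms. k + (if \<pi> \<in> E then 1 else 0))"
  proof (rule sum_mono)
    fix \<pi> assume "\<pi> \<in> perms"
    then show "hits \<pi> F + (if \<pi> \<in> D then 1 else 0) \<le> k + (if \<pi> \<in> E then 1 else 0)"
      using hits_le[of \<pi>] by (auto simp: D_def)
  qed
  moreover have ind: "(\<Sum>\<pi>\<in>perms. if \<pi> \<in> X then 1 else 0) = card X" if "X \<subseteq> perms" for X
    using that finite_perms by (simp add: sum.If_cases Int_absorb1)
  have "D \<subseteq> perms" "E \<subseteq> perms" by (auto simp: D_def E_def)
  ultimately have "(\<Sum>\<pi>\<in>perms. hits \<pi> F) + card D \<le> k * fact n + card E"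
    by (simp add: sum.distrib card_perms ind ac_simps)
  then show ?thesis using E_le D_ge by linarith
qed

section \<open>The general position number\<close>

lemma finite_general_position: "finite {F. K.general_position F}"
  by (rule finite_subset[of _ "Pow V"]) (use general_position_subset_V finite_V in auto)

lemma gp_eqI:
  assumes "K.general_position S" and "\<And>F. K.general_position F \<Longrightarrow> card F \<le> card S"
  shows "K.gp = card S"
  using assms finite_general_position unfolding K.gp_def by (intro Max_eqI) auto

lemma ex_gp: "\<exists>F. K.general_position F \<and> K.gp = card F"
proof -
  have "K.general_position {}" by (simp add: K.general_position_def)
  then have "Max (card ` {F. K.general_position F}) \<in> card ` {F. K.general_position F}"
    using finite_general_position by (intro Max_in) auto
  then show ?thesis unfolding K.gp_def by auto
qed

lemma disjoint_trans_if_general_position: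
  "K.general_position F \<Longrightarrow> disjoint_trans F"
  unfolding disjoint_trans_def using general_position_disjoint_trans by blast

lemma card_general_position_le:
  assumes gp: "K.general_position F" and k4: "4 \<le> k"
  shows "card F \<le> (n - 1) choose (k - 1)"
proof -
  have F: "F \<subseteq> V" and tr: "disjoint_trans F"
    using gp general_position_subset_V disjoint_trans_if_general_position by auto
  show ?thesis
  proof (cases "n + 2 \<le> 3 * k")
    case True
    have "hits \<pi> F \<le> k" if "\<pi> \<in> perms" for \<pi>
      by (rule hits_le_if_balanced[OF tr _ True that]) (rule general_position_balanced[OF gp])
    then have "(\<Sum>\<pi>\<in>perms. hits \<pi> F) \<le> (\<Sum>\<pi>\<in>perms. k)" by (rule sum_mono)
    then show ?thesis by (intro card_le_if_sum_hits(1)[OF F]) (simp add: card_perms ac_simps)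
  next
    case False
    show ?thesis
    proof (cases "\<forall>A\<in>F. \<forall>B\<in>F. A \<noteq> B \<longrightarrow> A \<inter> B = {}")
      case True
      then show ?thesis using k4 by (intro card_disjoint_family_le[OF F]) auto
    next
      case not_disjoint: False
      have "(\<Sum>\<pi>\<in>perms. hits \<pi> F) \<le> k * fact n"
      proof (rule sum_hits_le_if_sparse[OF F tr _ k4])
        fix D assume D: "D \<subseteq> F" "\<And>A B. A \<in> D \<Longrightarrow> B \<in> D \<Longrightarrow> A \<noteq> B \<Longrightarrow> A \<inter> B = {}"
        show "card D \<le> k"
        proof (rule ccontr)
          assume "\<not> card D \<le> k"
          then have "k < card D" by simp
          then show False using all_disjoint_if_many_disjoint[OF F tr D] not_disjoint by blast
        qed
      qed (use False in simp)
      then show ?thesis by (rule card_le_if_sum_hits(1)[OF F])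
    qed
  qed
qed

lemma card_general_position_less:
  assumes gp: "K.general_position F" and k4: "4 \<le> k" and n: "2 * n + 2 \<le> 5 * k"
  shows "card F < (n - 1) choose (k - 1)"
proof -
  have F: "F \<subseteq> V" and tr: "disjoint_trans F"
    using gp general_position_subset_V disjoint_trans_if_general_position by auto
  have n': "n + 2 \<le> 3 * k" using n n_ge by simp
  obtain \<pi>' where \<pi>': "\<pi>' \<in> perms" "hits \<pi>' F < k"
    by (rule ex_hits_less_if_balanced[OF F tr general_position_balanced[OF gp]
          general_position_no_middle[OF gp] k4 n])
  have "hits \<pi> F \<le> k" if "\<pi> \<in> perms" for \<pi>
    by (rule hits_le_if_balanced[OF tr _ n' that]) (rule general_position_balanced[OF gp])
  then have "(\<Sum>\<pi>\<in>perms. hits \<pi> F) < (\<Sum>\<pi>\<in>perms. k)"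
    using \<pi>' finite_perms by (intro sum_strict_mono_ex1) auto
  then show ?thesis by (intro card_le_if_sum_hits(2)[OF F]) (simp add: card_perms ac_simps)
qed

lemma card_star: "card {A \<in> V. 1 \<in> A} = (n - 1) choose (k - 1)"
proof -
  have "bij_betw (insert 1) {B. B \<subseteq> {2..n} \<and> card B = k - 1} {A \<in> V. 1 \<in> A}"
  proof (rule bij_betw_byWitness[where f' = "\<lambda>A. A - {1}"])
    show "insert 1 ` {B. B \<subseteq> {2..n} \<and> card B = k - 1} \<subseteq> {A \<in> V. 1 \<in> A}"
    proof clarify
      fix B :: "nat set" assume B: "B \<subseteq> {2..n}" "card B = k - 1"
      then have "finite B" "1 \<notin> B" using finite_subset by auto
      then show "insert 1 B \<in> V \<and> 1 \<in> insert 1 B" using B k_pos n_ge by (force simp: V_def)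
    qed
    show "(\<lambda>A. A - {1}) ` {A \<in> V. 1 \<in> A} \<subseteq> {B. B \<subseteq> {2..n} \<and> card B = k - 1}"
    proof clarify
      fix A :: "nat set" assume A: "A \<in> V" "1 \<in> A"
      have "A - {1} \<subseteq> {2..n}"
      proof
        fix x assume "x \<in> A - {1}"
        then have "x \<in> {1..n}" "x \<noteq> 1" using V_D(1)[OF A(1)] by auto
        then show "x \<in> {2..n}" by auto
      qed
      then show "A - {1} \<subseteq> {2..n} \<and> card (A - {1}) = k - 1"
        using V_D[OF A(1)] A(2) by simp
    qed
  qed auto
  then have "card {A \<in> V. 1 \<in> A} = card {B. B \<subseteq> {2..n} \<and> card B = k - 1}"
    by (simp add: bij_betw_same_card)
  also have "\<dots> = (n - 1) choose (k - 1)" using n_subsets[of "{2..n}" "k - 1"] by simp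
  finally show ?thesis .
qed

end

theorem theorem2:
  fixes n k :: nat
  assumes "n \<ge> 4" and "k \<ge> 4" and "n \<ge> 2 * k + 1"
  shows "pre_digraph.gp (with_proj (kneser_graph n k)) \<le> (n - 1) choose (k - 1)
    \<and> (real n \<ge> 2.5 * real k - 0.5 \<longrightarrow>
         pre_digraph.gp (with_proj (kneser_graph n k)) = (n - 1) choose (k - 1))
    \<and> (2 * k + 1 \<le> n \<and> real n < 2.5 * real k - 0.5 \<longrightarrow>
         pre_digraph.gp (with_proj (kneser_graph n k)) < (n - 1) choose (k - 1))"
proof -
  interpret kneser n k using assms by unfold_locales auto
  obtain F where F: "K.general_position F" "K.gp = card F" using ex_gp by blast
  show ?thesis
  proof (intro conjI impI)
    show "K.gp \<le> (n - 1) choose (k - 1)" using card_general_position_le F assms by simp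
  next
    assume "real n \<ge> 2.5 * real k - 0.5"
    \<comment> \<open>The assumption says \<open>2 * n \<ge> 5 * k - 1\<close>, which is this
      inequality in terms of \<open>r\<close>.\<close>
    then have "k \<le> 2 * r + 1" using assms by linarith
    then have "K.general_position {A \<in> V. 1 \<in> A}" by (rule star_general_position)
    then show "K.gp = (n - 1) choose (k - 1)"
      using gp_eqI[of "{A \<in> V. 1 \<in> A}"] card_general_position_le assms(2) card_star by simp
  next
    assume "2 * k + 1 \<le> n \<and> real n < 2.5 * real k - 0.5"
    \<comment> \<open>Both sides of \<open>2 * n < 5 * k - 1\<close> are integers, so the strict
      inequality gains one.\<close>
    then have "2 * n + 2 \<le> 5 * k" by linarith
    then show "K.gp < (n - 1) choose (k - 1)" using card_general_position_less F assms by simp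
  qed
qed

end
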